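(* Let $n\ge2$ and suppose that $\Omega\in L^s(\mathbf{S}^{n-1})$ with $1<s\leq\infty$, where $\Omega$ is homogeneous of degree zero on $\mathbb R^n$. Let $0<\alpha<n$, $s'\leq p,q<\infty$, and $\frac1p+\frac1q=\frac1r+\frac{\alpha}{n(1-\kappa)}$ with $0<r<\min\{p,q\}$ and $0<\kappa<1$. (i) If $s'<p,q<\infty$, then there exists a constant $C>0$ such that for any $f\in L^{p,\kappa}(\mathbb R^n)$ and $g\in L^{q,\kappa}(\mathbb R^n)$ ($C$ independent of $f$ and $g$), $\|f\cdot T_{\Omega,\alpha}(g)\|_{L^{r,\kappa}}\leq C\|f\|_{L^{p,\kappa}}\|g\|_{L^{q,\kappa}}$. (ii) If $s'=p$ and $s'<q<\infty$ (or $s'=q$ and $s'<p<\infty$), then there exists a constant $C>0$ such that for any $f\in L^{p,\kappa}(\mathbb R^n)$ and $g\in L^{q,\kappa}(\mathbb R^n)$ ($C$ independent of $f$ and $g$), $\|f\cdot T_{\Omega,\alpha}(g)\|_{WL^{r,\kappa}}\leq C\|f\|_{L^{p,\kappa}}\|g\|_{L^{q,\kappa}}$.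
   Context: $\mathbf{S}^{n-1}$ is the unit sphere of $\mathbb R^n$ with normalized Lebesgue measure; $m$ is Lebesgue measure; $1/s+1/s'=1$ ($s'=1$ if $s=\infty$). $T_{\Omega,\alpha}g(x):=\int_{\mathbb R^n}\frac{\Omega(x-y)}{|x-y|^{n-\alpha}}g(y)\,dy$. For $0<p<\infty$ and $0<\kappa<1$, $\|f\|_{L^{p,\kappa}}:=\sup_{B}\big(\frac{1}{m(B)^{\kappa}}\int_B|f(x)|^p\,dx\big)^{1/p}$ and $\|f\|_{WL^{p,\kappa}}:=\sup_{B}\frac{1}{m(B)^{\kappa/p}}\sup_{\lambda>0}\lambda\, m(\{x\in B:|f(x)|>\lambda\})^{1/p}$, with suprema over all balls $B\subset\mathbb R^n$; $L^{p,\kappa}(\mathbb R^n)$ and $WL^{p,\kappa}(\mathbb R^n)$ are the (weak) Morrey spaces of measurable functions for which these are finite. *)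

theory Defs
  imports "HOL-Analysis.Analysis"
begin

text \<open>
  The normalized Lebesgue measure on the unit sphere, as the cone measure:
  a Borel set \<open>A\<close> of directions has measure \<open>m {x \<in> B. x / |x| \<in> A} / m B\<close>, with \<open>B\<close> the unit ball
  (the origin, which \<open>sgn\<close> sends to \<open>0\<close>, is null). The completion makes all Lebesgue
  measurable functions on the sphere admissible.
\<close>

definition sphere_measure :: "'a::euclidean_space measure" where
  "sphere_measure =
     completion (restrict_space (distr (uniform_measure lborel (ball 0 1)) borel sgn) (sphere 0 1))"

lemma emeasure_sphere_measure:
  fixes A :: "'a::euclidean_space set"
  assumes "A \<in> sets borel" "A \<subseteq> sphere 0 1"
  shows "emeasure sphere_measure A =
           emeasure lborel {x \<in> ball 0 1. sgn x \<in> A} / emeasure lborel (ball (0::'a) 1)"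
proof -
  have sgn: "sgn \<in> borel_measurable (borel :: 'a measure)"
    unfolding sgn_div_norm[abs_def] by measurable
  have pre: "sgn -` A \<in> sets (borel :: 'a measure)"
    using measurable_sets[OF sgn assms(1)] by simp
  have A: "A \<in> sets (restrict_space (distr (uniform_measure lborel (ball 0 1)) borel sgn) (sphere 0 1))"
    using assms by (auto simp: sets_restrict_space)
  have eq: "ball 0 1 \<inter> sgn -` A = {x \<in> ball 0 1. sgn x \<in> A}" by auto
  have "emeasure sphere_measure A = emeasure (distr (uniform_measure lborel (ball 0 1)) borel sgn) A"
    unfolding sphere_measure_def using A assms
    by (subst emeasure_completion) (simp_all add: emeasure_restrict_space)
  also have "\<dots> = emeasure (uniform_measure lborel (ball (0::'a) 1)) (sgn -` A)"
    using sgn assms(1) by (subst emeasure_distr) auto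
  also have "\<dots> = emeasure lborel {x \<in> ball 0 1. sgn x \<in> A} / emeasure lborel (ball (0::'a) 1)"
    using pre eq by (simp add: emeasure_uniform_measure)
  finally show ?thesis .
qed

definition Lp_space :: "'a measure \<Rightarrow> ennreal \<Rightarrow> ('a \<Rightarrow> complex) set" where
  "Lp_space M s = {f \<in> borel_measurable M.
     if s = \<infinity> then (\<exists>K::real. AE x in M. norm (f x) \<le> K)
     else (\<integral>\<^sup>+ x. ennreal (norm (f x) powr enn2real s) \<partial>M) < \<infinity>}"

definition homogeneous_degree_zero :: "('a::real_vector \<Rightarrow> 'b) \<Rightarrow> bool" where
  "homogeneous_degree_zero \<Omega> \<longleftrightarrow> (\<forall>t>0. \<forall>x. \<Omega> (t *\<^sub>R x) = \<Omega> x)"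

definition rough_kernel :: "('a::euclidean_space \<Rightarrow> complex) \<Rightarrow> real \<Rightarrow> 'a \<Rightarrow> complex" where
  "rough_kernel \<Omega> \<alpha> z = \<Omega> z / of_real (norm z powr (real DIM('a) - \<alpha>))"

text \<open>
  As a Bochner integral this is \<open>0\<close> wherever the integral does not converge absolutely;
  convergence has to be stated separately.
\<close>

definition rough_integral ::
    "('a::euclidean_space \<Rightarrow> complex) \<Rightarrow> real \<Rightarrow> ('a \<Rightarrow> complex) \<Rightarrow> 'a \<Rightarrow> complex" where
  "rough_integral \<Omega> \<alpha> g x = (\<integral>y. rough_kernel \<Omega> \<alpha> (x - y) * g y \<partial>lebesgue)"

text \<open>Powers with exponent \<open>a > 0\<close>, so that \<open>\<infinity>\<close> is mapped to \<open>\<infinity>\<close>.\<close>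

definition ennreal_powr :: "ennreal \<Rightarrow> real \<Rightarrow> ennreal" where
  "ennreal_powr x a = (if x = \<infinity> then \<infinity> else ennreal (enn2real x powr a))"

definition morrey_norm :: "real \<Rightarrow> real \<Rightarrow> ('a::euclidean_space \<Rightarrow> complex) \<Rightarrow> ennreal" where
  "morrey_norm p \<kappa> f =
     (SUP (c, R) \<in> UNIV \<times> {0<..}.
        ennreal_powr
          ((\<integral>\<^sup>+ x \<in> ball c R. ennreal (norm (f x) powr p) \<partial>lebesgue)
             / ennreal_powr (emeasure lebesgue (ball c R)) \<kappa>)
          (1 / p))"

definition weak_morrey_norm :: "real \<Rightarrow> real \<Rightarrow> ('a::euclidean_space \<Rightarrow> complex) \<Rightarrow> ennreal" where
  "weak_morrey_norm p \<kappa> f =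
     (SUP (c, R) \<in> UNIV \<times> {0<..}.
        (SUP t \<in> {0<..}.
           ennreal t * ennreal_powr (emeasure lebesgue {x \<in> ball c R. t < norm (f x)}) (1 / p))
        / ennreal_powr (emeasure lebesgue (ball c R)) (\<kappa> / p))"

definition morrey_space :: "real \<Rightarrow> real \<Rightarrow> ('a::euclidean_space \<Rightarrow> complex) set" where
  "morrey_space p \<kappa> = {f \<in> borel_measurable lebesgue. morrey_norm p \<kappa> f < \<infinity>}"

definition weak_morrey_space :: "real \<Rightarrow> real \<Rightarrow> ('a::euclidean_space \<Rightarrow> complex) set" where
  "weak_morrey_space p \<kappa> = {f \<in> borel_measurable lebesgue. weak_morrey_norm p \<kappa> f < \<infinity>}"

end

theory Submission
  imports Defs
begin

text \<open>
  Put \<open>1/t = 1/r - 1/p = 1/q - \<alpha>/(n(1-\<kappa>))\<close>. Hoelder's inequality on each ball, strong or weak, reduces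
  the theorem to Adams' bound for \<open>T = T_{\<Omega>,\<alpha>}\<close> from \<open>L^{q,\<kappa>}\<close> to \<open>L^{t,\<kappa>}\<close> when \<open>s' < q\<close>, and to
  \<open>WL^{t,\<kappa>}\<close> when \<open>s' = q\<close>.

  As \<open>|z|^{\<alpha>-n}\<close> is an integral of powers of \<open>\<rho>\<close> over \<open>\<rho> > |z|\<close>, only the integrals of
  \<open>|\<Omega>(x-y)| |g(y)|\<close> over the balls \<open>B(x,\<rho>)\<close> enter. Hoelder's inequality with exponents \<open>s, s'\<close> bounds
  them by the mean of \<open>|g|^{s'}\<close>: for small \<open>\<rho>\<close> this is at most the maximal function \<open>M(|g|^{s'})(x)\<close>, for
  large \<open>\<rho>\<close> the Morrey norm of \<open>g\<close> takes over. Optimising the threshold gives Hedberg's inequality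
  \<open>|T g| \<le> C M(|g|^{s'})^{(1-\<theta>)/s'} \<parallel>g\<parallel>^\<theta>\<close> with \<open>\<theta> = 1 - q/t\<close>.

  The maximal function is bounded on Morrey spaces because, at points of a ball \<open>B\<close>, averages over
  balls larger than \<open>B\<close> are controlled by the Morrey norm, and the others see \<open>g\<close> only on \<open>3B\<close>.
\<close>

section \<open>Hoelder's inequality and power integrals\<close>

text \<open>All estimates are made for a positive integral with values in \<open>ennreal\<close>,
  which always has a meaning. It dominates the Bochner integral at every point, because the latter
  is 0 where absolute convergence fails, and its finiteness almost everywhere gives the convergence.
  A second obstacle is measurability: \<Omega> is measurable only on the sphere, up to null sets,
  and g is only Lebesgue measurable, while Fubini is applied to Borel functions. Both are replaced
  by Borel representatives; homogeneity turns null sets of directions into null cones. The number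
  behind the exponents is \<beta> = n(1-\<kappa>)/q: the L^q means of g over balls of radius \<rho>
  are O(\<rho>^(-\<beta>)). Against the gain \<rho>^\<alpha> of the kernel this is integrable at
  infinity when \<alpha> < \<beta>, which is what r < p amounts to, and \<theta> = \<alpha>/\<beta>.
  The definition of t says (1-\<theta>)t = q, so the t-th power of Hedberg's bound contains the
  maximal function to the power q/s', the exponent for which |g|^s' has a Morrey bound. This
  exponent exceeds 1 unless s' = q, where only the weak type of the maximal function
  survives.\<close>

lemma nn_integral_Holder:
  fixes f g :: "'a \<Rightarrow> real"
  assumes [measurable]: "f \<in> borel_measurable M" "g \<in> borel_measurable M"
    and nn: "\<And>x. 0 \<le> f x" "\<And>x. 0 \<le> g x"
    and pq: "p > 1" "q > 1" "1 / p + 1 / q = 1" and AB: "0 \<le> A" "0 \<le> B"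
    and f: "(\<integral>\<^sup>+x. ennreal (f x powr p) \<partial>M) \<le> ennreal (A powr p)"
    and g: "(\<integral>\<^sup>+x. ennreal (g x powr q) \<partial>M) \<le> ennreal (B powr q)"
  shows "(\<integral>\<^sup>+x. ennreal (f x * g x) \<partial>M) \<le> ennreal (A * B)"
\<comment> \<open>Young's inequality is applied to \<open>f x / A\<close> and
  \<open>g x / B\<close>, so a vanishing bound is settled apart: it forces one factor to be 0 almost
  everywhere.\<close>
proof (cases "A = 0 \<or> B = 0")
  case True
  then have "(\<integral>\<^sup>+x. ennreal (f x powr p) \<partial>M) = 0 \<or> (\<integral>\<^sup>+x. ennreal (g x powr q) \<partial>M) = 0"
    using f g by auto
  then have "(AE x in M. f x = 0) \<or> (AE x in M. g x = 0)"
    by (auto simp: nn_integral_0_iff_AE)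
  then have "AE x in M. ennreal (f x * g x) = 0"
    by (auto elim: eventually_mono)
  then have "(\<integral>\<^sup>+x. ennreal (f x * g x) \<partial>M) = (\<integral>\<^sup>+x. 0 \<partial>M)"
    by (rule nn_integral_cong_AE)
  then show ?thesis by simp
next
  case False
  then have pos: "A > 0" "B > 0" using AB by auto
  have "f x * g x \<le> A * B / p * (f x powr p / A powr p) + A * B / q * (g x powr q / B powr q)" for x
  proof -
    have "(f x / A) * (g x / B) \<le> (f x / A) powr p / p + (g x / B) powr q / q"
      using nn pos pq by (intro Youngs_inequality) auto
    then have "A * B * ((f x / A) * (g x / B))
        \<le> A * B * ((f x / A) powr p / p + (g x / B) powr q / q)"
      using pos by (intro mult_left_mono) auto
    then show ?thesis
      using nn[of x] pos by (simp add: powr_divide field_simps)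
  qed
  then have "(\<integral>\<^sup>+x. ennreal (f x * g x) \<partial>M) \<le>
      (\<integral>\<^sup>+x. ennreal (A * B / p / A powr p) * ennreal (f x powr p)
          + ennreal (A * B / q / B powr q) * ennreal (g x powr q) \<partial>M)"
    using pos pq
    by (intro nn_integral_mono)
      (auto simp flip: ennreal_mult ennreal_plus intro!: ennreal_leI)
  also have "\<dots> = ennreal (A * B / p / A powr p) * (\<integral>\<^sup>+x. ennreal (f x powr p) \<partial>M)
          + ennreal (A * B / q / B powr q) * (\<integral>\<^sup>+x. ennreal (g x powr q) \<partial>M)"
    by (simp add: nn_integral_add nn_integral_cmult)
  also have "\<dots> \<le> ennreal (A * B / p / A powr p) * ennreal (A powr p)
          + ennreal (A * B / q / B powr q) * ennreal (B powr q)"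
    using f g by (intro add_mono mult_left_mono) auto
  also have "\<dots> = ennreal (A * B / p + A * B / q)"
    using pos pq by (simp flip: ennreal_mult ennreal_plus)
  also have "A * B / p + A * B / q = A * B * (1 / p + 1 / q)"
    by (simp add: distrib_left)
  finally show ?thesis using pq by simp
qed

lemma nn_integral_powr_from_0:
  fixes a y :: real
  assumes "a > 0" "y \<ge> 0"
  shows "(\<integral>\<^sup>+t\<in>{0<..<y}. ennreal (t powr (a - 1)) \<partial>lborel) = ennreal (y powr a / a)"
proof -
  have "((\<lambda>t. t powr (a - 1)) has_integral (y powr (a - 1 + 1) / (a - 1 + 1))) {0..y}"
    using assms by (intro has_integral_powr_from_0) auto
  then have "((\<lambda>t. t powr (a - 1)) has_integral (y powr a / a)) {0..y}" by simp
  from nn_integral_has_integral_lebesgue[OF _ this]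
  have "(\<integral>\<^sup>+t. ennreal (indicator {0..y} t * t powr (a - 1)) \<partial>lborel) = ennreal (y powr a / a)"
    by (simp add: nn_integral_completion)
  moreover have "AE t in lborel. t \<noteq> 0 \<and> t \<noteq> y"
    by (intro eventually_conj AE_lborel_singleton)
  then have "(\<integral>\<^sup>+t\<in>{0<..<y}. ennreal (t powr (a - 1)) \<partial>lborel)
      = (\<integral>\<^sup>+t. ennreal (indicator {0..y} t * t powr (a - 1)) \<partial>lborel)"
    by (intro nn_integral_cong_AE, elim eventually_mono) (auto split: split_indicator)
  ultimately show ?thesis by simp
qed

lemma nn_integral_powr_to_infinity:
  fixes a y :: real
  assumes "a > 0" "y > 0"
  shows "(\<integral>\<^sup>+t\<in>{y<..}. ennreal (t powr (- a - 1)) \<partial>lborel) = ennreal (y powr (- a) / a)"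
proof -
  have "((\<lambda>t. t powr (- a - 1)) has_integral - (y powr (- a - 1 + 1)) / (- a - 1 + 1)) {y..}"
    using assms by (intro has_integral_powr_to_inf) auto
  then have "((\<lambda>t. t powr (- a - 1)) has_integral (y powr - a / a)) {y..}" by simp
  from nn_integral_has_integral_lebesgue[OF _ this]
  have "(\<integral>\<^sup>+t. ennreal (indicator {y..} t * t powr (- a - 1)) \<partial>lborel) = ennreal (y powr - a / a)"
    by (simp add: nn_integral_completion)
  moreover have "AE t in lborel. t \<noteq> y"
    by (simp add: AE_lborel_singleton)
  then have "(\<integral>\<^sup>+t\<in>{y<..}. ennreal (t powr (- a - 1)) \<partial>lborel)
      = (\<integral>\<^sup>+t. ennreal (indicator {y..} t * t powr (- a - 1)) \<partial>lborel)"
    by (intro nn_integral_cong_AE, elim eventually_mono) (auto split: split_indicator)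
  ultimately show ?thesis by simp
qed

section \<open>Volumes of balls\<close>

lemma measure_ball_eq:
  fixes c :: "'a::euclidean_space"
  assumes "R \<ge> 0"
  shows "measure lborel (ball c R) = unit_ball_vol DIM('a) * R ^ DIM('a)"
  using assms by (simp add: measure_def emeasure_ball)

lemma measure_ball_pos: "R > 0 \<Longrightarrow> 0 < measure lborel (ball c R)"
  for c :: "'a::euclidean_space"
  by (simp add: measure_ball_eq)

lemma emeasure_ball_measure: "emeasure lborel (ball c R) = ennreal (measure lborel (ball c R))"
  for c :: "'a::euclidean_space"
  using emeasure_lborel_ball_finite[of c R] by (simp add: emeasure_eq_ennreal_measure less_top)

section \<open>The uncentred maximal function\<close>

text \<open>Balls need not be centred at \<open>x\<close>: this makes the superlevel sets open, so
  that measurability costs nothing. Membership of \<open>x\<close> already forces a positive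
  radius.\<close>

definition maximal_function :: "('a::euclidean_space \<Rightarrow> real) \<Rightarrow> 'a \<Rightarrow> ennreal" where
  "maximal_function w x =
     (SUP (c, \<rho>) \<in> {(c, \<rho>). x \<in> ball c \<rho>}.
        (\<integral>\<^sup>+y\<in>ball c \<rho>. ennreal (w y) \<partial>lborel) / emeasure lborel (ball c \<rho>))"

text \<open>A strict inequality below a supremum yields a witness, here a ball, and the division may
  be cleared because the volume is positive and finite. Most later arguments enter the maximal
  function through this form.\<close>

lemma less_maximal_function_iff:
  "l < maximal_function w x \<longleftrightarrow>
     (\<exists>c \<rho>. x \<in> ball c \<rho> \<and> l * emeasure lborel (ball c \<rho>) < (\<integral>\<^sup>+y\<in>ball c \<rho>. ennreal (w y) \<partial>lborel))"
proof -
  have *: "l < a / b \<longleftrightarrow> l * b < a" if "b \<noteq> 0" "b < top" for a b :: ennreal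
  proof -
    have "a / b * b = a"
      using that by (simp add: ennreal_divide_times)
    then have "a / b \<le> l \<longleftrightarrow> a \<le> l * b"
      using that
      by (metis divide_le_posI_ennreal mult.commute mult_right_mono zero_le not_gr_zero)
    then show ?thesis by (simp add: not_le[symmetric])
  qed
  have "l < a / emeasure lborel (ball c \<rho>) \<longleftrightarrow> l * emeasure lborel (ball c \<rho>) < a"
    if "x \<in> ball c \<rho>" for a c \<rho>
  proof (rule *)
    have "\<rho> > 0" using that zero_le_dist[of c x] unfolding mem_ball by linarith
    then show "emeasure lborel (ball c \<rho>) \<noteq> 0"
      using measure_ball_pos[of \<rho> c] by (simp add: emeasure_ball_measure)
    show "emeasure lborel (ball c \<rho>) < top"
      using emeasure_lborel_ball_finite by (simp add: less_top)
  qed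
  moreover have "l < maximal_function w x \<longleftrightarrow>
     (\<exists>c \<rho>. x \<in> ball c \<rho> \<and>
        l < (\<integral>\<^sup>+y\<in>ball c \<rho>. ennreal (w y) \<partial>lborel) / emeasure lborel (ball c \<rho>))"
    unfolding maximal_function_def by (auto simp: less_SUP_iff)
  ultimately show ?thesis by (simp cong: conj_cong)
qed

lemma ball_average_le_maximal_function:
  assumes "x \<in> ball c \<rho>"
  shows "(\<integral>\<^sup>+y\<in>ball c \<rho>. ennreal (w y) \<partial>lborel) \<le> maximal_function w x * emeasure lborel (ball c \<rho>)"
proof (rule ccontr)
  assume "\<not> ?thesis"
  then have "maximal_function w x < maximal_function w x"
    using assms by (subst less_maximal_function_iff) (auto simp: not_le)
  then show False by simp
qed

text \<open>A ball that witnesses the level at one point witnesses it at all of its points, so the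
  set is a union of open balls.\<close>

lemma open_maximal_function_superlevel: "open {x. l < maximal_function w x}"
  unfolding less_maximal_function_iff
  by (intro open_Collect_ex open_Collect_conj open_Collect_const) (simp del: mem_ball)

lemma borel_measurable_maximal_function [measurable]: "maximal_function w \<in> borel_measurable borel"
  by (rule borel_measurableI_greater) (simp add: open_maximal_function_superlevel)

text \<open>Countable subadditivity with the sum written as an integral over
  \<open>count_space\<close>, so that the family of pairs (centre, radius) from the covering lemma
  needs no enumeration.\<close>

lemma emeasure_UN_countable_le:
  assumes [measurable]: "\<And>i. i \<in> I \<Longrightarrow> X i \<in> sets M" and "countable I"
  shows "emeasure M (\<Union>(X ` I)) \<le> (\<integral>\<^sup>+i. emeasure M (X i) \<partial>count_space I)"
proof -
  have "indicator (\<Union>(X ` I)) x \<le> (\<integral>\<^sup>+i. indicator (X i) x \<partial>count_space I :: ennreal)" for x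
  proof (cases "x \<in> \<Union>(X ` I)")
    case True
    then obtain i where i: "i \<in> I" "x \<in> X i" by auto
    then show ?thesis
      using nn_integral_ge_point[OF i(1), of "\<lambda>i. indicator (X i) x"] True by simp
  qed simp
  then have "(\<integral>\<^sup>+x. indicator (\<Union>(X ` I)) x \<partial>M) \<le> (\<integral>\<^sup>+x. (\<integral>\<^sup>+i. indicator (X i) x \<partial>count_space I) \<partial>M)"
    by (intro nn_integral_mono)
  also have "\<dots> = (\<integral>\<^sup>+i. (\<integral>\<^sup>+x. indicator (X i) x \<partial>M) \<partial>count_space I)"
    using assms by (subst nn_integral_count_space_nn_integral) auto
  also have "\<dots> = (\<integral>\<^sup>+i. emeasure M (X i) \<partial>count_space I)"
    by (intro nn_integral_cong) simp
  finally show ?thesis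
    using assms by (subst (asm) nn_integral_indicator) auto
qed

text \<open>Vitali's covering lemma: the superlevel set is covered by the fivefold dilates of
  disjoint balls whose averages exceed \<open>l\<close>. Each dilate has \<open>5 ^ DIM('a)\<close>
  times the volume of its ball, and the integrals over disjoint balls add up to at most the whole
  integral.\<close>

lemma maximal_function_weak_type:
  fixes w :: "'a::euclidean_space \<Rightarrow> real"
  assumes [measurable]: "w \<in> borel_measurable borel" and l: "l > 0"
  shows "emeasure lborel {x. ennreal l < maximal_function w x}
           \<le> ennreal (5 ^ DIM('a) / l) * (\<integral>\<^sup>+x. ennreal (w x) \<partial>lborel)"
proof (cases "(\<integral>\<^sup>+x. ennreal (w x) \<partial>lborel) = \<infinity>")
  case True
  then show ?thesis using l by (simp add: ennreal_mult_top)
next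
  case False
  then obtain I where I: "(\<integral>\<^sup>+x. ennreal (w x) \<partial>lborel) = ennreal I" "I \<ge> 0"
    by (cases "\<integral>\<^sup>+x. ennreal (w x) \<partial>lborel") auto
  let ?d = "DIM('a)" and ?\<omega> = "unit_ball_vol DIM('a)"
  let ?b = "\<lambda>i::'a \<times> real. ball (fst i) (snd i)"
  define K where "K = {i::'a \<times> real. snd i > 0 \<and>
      ennreal l * emeasure lborel (?b i) < (\<integral>\<^sup>+y\<in>?b i. ennreal (w y) \<partial>lborel)}"
  have cover: "{x. ennreal l < maximal_function w x} \<subseteq> (\<Union>i\<in>K. ?b i)"
  proof safe
    fix x assume "ennreal l < maximal_function w x"
    then obtain c \<rho> where *: "x \<in> ball c \<rho>"
      "l * emeasure lborel (ball c \<rho>) < (\<integral>\<^sup>+y\<in>ball c \<rho>. ennreal (w y) \<partial>lborel)"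
      unfolding less_maximal_function_iff by auto
    moreover from *(1) have "\<rho> > 0" using zero_le_dist[of c x] unfolding mem_ball by linarith
    ultimately show "x \<in> (\<Union>i\<in>K. ?b i)"
      by (intro UN_I[of "(c, \<rho>)"]) (auto simp: K_def)
  qed
  \<comment> \<open>The covering lemma requires bounded radii. A ball in \<open>K\<close> has volume
    at most \<open>I / l\<close>; since a radius above 1 is at most its power \<open>?d\<close>, the
    maximum with 1 avoids extracting a root.\<close>
  have bound: "0 < snd i \<and> snd i \<le> max 1 (I / (l * ?\<omega>))" if "i \<in> K" for i
  proof -
    have pos: "snd i > 0" using that by (simp add: K_def)
    have "ennreal l * emeasure lborel (?b i) \<le> (\<integral>\<^sup>+y\<in>?b i. ennreal (w y) \<partial>lborel)"
      using that by (simp add: K_def less_imp_le)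
    also have "\<dots> \<le> (\<integral>\<^sup>+y. ennreal (w y) \<partial>lborel)"
      by (intro nn_integral_mono) (auto split: split_indicator)
    finally have "ennreal (l * (?\<omega> * snd i ^ ?d)) \<le> ennreal I"
      using l pos by (simp add: I emeasure_ball ennreal_mult)
    then have "l * (?\<omega> * snd i ^ ?d) \<le> I" using I by simp
    then have *: "snd i ^ ?d \<le> I / (l * ?\<omega>)" using l by (simp add: field_simps)
    have "snd i \<le> max 1 (I / (l * ?\<omega>))"
    proof (cases "snd i \<le> 1")
      case False
      then have "snd i \<le> snd i ^ ?d"
        by (intro self_le_power) auto
      with * show ?thesis by simp
    qed simp
    with pos show ?thesis by simp
  qed
  obtain C where C: "countable C" "C \<subseteq> K" "pairwise (\<lambda>i j. disjnt (?b i) (?b j)) C"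
     "{x. ennreal l < maximal_function w x} \<subseteq> (\<Union>i\<in>C. ball (fst i) (5 * snd i))"
    using Vitali_covering_lemma_balls[OF cover bound] by blast
  have disj: "disjoint_family_on ?b C"
    using C(3) by (auto simp: pairwise_def disjoint_family_on_def disjnt_def)
  have "emeasure lborel {x. ennreal l < maximal_function w x}
      \<le> emeasure lborel (\<Union>i\<in>C. ball (fst i) (5 * snd i))"
    using C by (intro emeasure_mono) auto
  also have "\<dots> \<le> (\<integral>\<^sup>+i. emeasure lborel (ball (fst i) (5 * snd i)) \<partial>count_space C)"
    using C by (intro emeasure_UN_countable_le) auto
  \<comment> \<open>Passing to \<open>density lborel w\<close> turns the sum over disjoint balls
    into the measure of their union.\<close>
  also have "\<dots> \<le> (\<integral>\<^sup>+i. ennreal (5 ^ ?d / l) * emeasure (density lborel w) (?b i) \<partial>count_space C)"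
  proof (intro nn_integral_mono)
    fix i assume "i \<in> space (count_space C)"
    then have i: "i \<in> K" using C by auto
    then have pos: "snd i > 0" by (simp add: K_def)
    have "emeasure lborel (ball (fst i) (5 * snd i)) = ennreal (5 ^ ?d / l) * (ennreal l * emeasure lborel (?b i))"
      using pos l by (simp add: emeasure_ball power_mult_distrib flip: ennreal_mult)
    also have "\<dots> \<le> ennreal (5 ^ ?d / l) * (\<integral>\<^sup>+y\<in>?b i. ennreal (w y) \<partial>lborel)"
      using i by (intro mult_left_mono) (auto simp: K_def)
    finally show "emeasure lborel (ball (fst i) (5 * snd i)) \<le> ennreal (5 ^ ?d / l) * emeasure (density lborel w) (?b i)"
      by (simp add: emeasure_density)
  qed
  also have "\<dots> = ennreal (5 ^ ?d / l) * (\<integral>\<^sup>+i. emeasure (density lborel w) (?b i) \<partial>count_space C)"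
    by (simp add: nn_integral_cmult)
  also have "(\<integral>\<^sup>+i. emeasure (density lborel w) (?b i) \<partial>count_space C) = emeasure (density lborel w) (\<Union>i\<in>C. ?b i)"
    using C disj by (intro emeasure_UN_countable[symmetric]) auto
  also have "\<dots> \<le> (\<integral>\<^sup>+x. ennreal (w x) \<partial>lborel)"
    using emeasure_space[of "density lborel w" "\<Union>i\<in>C. ?b i"]
    by (simp add: emeasure_density)
  finally show ?thesis by (simp add: mult_left_mono)
qed

text \<open>The set where the value is infinite lies in every superlevel set, whose measure at level
  k is O(1/k) by the weak type.\<close>

lemma maximal_function_finite_AE:
  fixes w :: "'a::euclidean_space \<Rightarrow> real"
  assumes [measurable]: "w \<in> borel_measurable borel" and fin: "(\<integral>\<^sup>+x. ennreal (w x) \<partial>lborel) < \<infinity>"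
  shows "AE x in lborel. maximal_function w x < \<infinity>"
proof -
  obtain I where I: "(\<integral>\<^sup>+x. ennreal (w x) \<partial>lborel) = ennreal I" "I \<ge> 0"
    using fin by (cases "\<integral>\<^sup>+x. ennreal (w x) \<partial>lborel") auto
  have "emeasure lborel {x. maximal_function w x = \<infinity>} \<le> ennreal (5 ^ DIM('a) * I / real (Suc k))" for k
  proof -
    have "emeasure lborel {x. maximal_function w x = \<infinity>}
        \<le> emeasure lborel {x. ennreal (real (Suc k)) < maximal_function w x}"
      by (intro emeasure_mono) (auto simp: less_top)
    also have "\<dots> \<le> ennreal (5 ^ DIM('a) / real (Suc k)) * (\<integral>\<^sup>+x. ennreal (w x) \<partial>lborel)"
      by (intro maximal_function_weak_type) auto
    finally show ?thesis using I by (simp add: field_simps flip: ennreal_mult)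
  qed
  moreover have "(\<lambda>k. ennreal (5 ^ DIM('a) * I / real (Suc k))) \<longlonglongrightarrow> ennreal 0"
    by (intro tendsto_ennrealI real_tendsto_divide_at_top[OF tendsto_const]
      filterlim_compose[OF filterlim_real_sequentially filterlim_Suc])
  ultimately have "emeasure lborel {x. maximal_function w x = \<infinity>} \<le> ennreal 0"
    by (intro LIMSEQ_le_const) auto
  then show ?thesis
    by (intro AE_I[where N="{x. maximal_function w x = \<infinity>}"]) (auto simp: less_top[symmetric])
qed

text \<open>Where \<open>w \<le> l/2\<close>, \<open>w\<close> adds at most \<open>l/2\<close> to an average, so it can be dropped at half the level.\<close>

lemma maximal_function_weak_type_truncated:
  fixes w :: "'a::euclidean_space \<Rightarrow> real"
  assumes [measurable]: "w \<in> borel_measurable borel" and l: "l > 0"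
  shows "emeasure lborel {x. ennreal l < maximal_function w x}
           \<le> ennreal (2 * 5 ^ DIM('a) / l) * (\<integral>\<^sup>+x. ennreal (w x) * indicator {..<2 * w x} l \<partial>lborel)"
proof -
  define w' where "w' x = w x * indicator {..<2 * w x} l" for x
  have [measurable]: "w' \<in> borel_measurable borel" unfolding w'_def by (measurable; simp)
  have "ennreal (l / 2) < maximal_function w' x" if x: "ennreal l < maximal_function w x" for x
  proof -
    obtain c \<rho> where b: "x \<in> ball c \<rho>"
      "ennreal l * emeasure lborel (ball c \<rho>) < (\<integral>\<^sup>+y\<in>ball c \<rho>. ennreal (w y) \<partial>lborel)"
      using x unfolding less_maximal_function_iff by auto
    have [measurable]: "ball c \<rho> \<in> sets borel" by simp
    define m where "m = emeasure lborel (ball c \<rho>)"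
    have m: "m < top"
      unfolding m_def using emeasure_lborel_ball_finite by (simp add: less_top)
    have half: "ennreal l * m = ennreal (l / 2) * m + ennreal (l / 2) * m"
      using l by (simp flip: distrib_right ennreal_plus)
    have "(\<integral>\<^sup>+y\<in>ball c \<rho>. ennreal (w y) \<partial>lborel)
        \<le> (\<integral>\<^sup>+y. ennreal (w' y) * indicator (ball c \<rho>) y + ennreal (l / 2) * indicator (ball c \<rho>) y \<partial>lborel)"
      by (intro nn_integral_mono) (auto simp: w'_def split: split_indicator intro!: ennreal_leI)
    also have "\<dots> = (\<integral>\<^sup>+y\<in>ball c \<rho>. ennreal (w' y) \<partial>lborel) + ennreal (l / 2) * m"
      unfolding m_def
      by (subst nn_integral_cmult_indicator[symmetric], simp, rule nn_integral_add) measurable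
    finally have le: "(\<integral>\<^sup>+y\<in>ball c \<rho>. ennreal (w y) \<partial>lborel)
        \<le> (\<integral>\<^sup>+y\<in>ball c \<rho>. ennreal (w' y) \<partial>lborel) + ennreal (l / 2) * m" .
    have "ennreal (l / 2) * m + ennreal (l / 2) * m
        < (\<integral>\<^sup>+y\<in>ball c \<rho>. ennreal (w' y) \<partial>lborel) + ennreal (l / 2) * m"
      using order.strict_trans2[OF b(2) le] half by (simp only: m_def)
    then have "ennreal (l / 2) * m < (\<integral>\<^sup>+y\<in>ball c \<rho>. ennreal (w' y) \<partial>lborel)"
      by (meson add_right_mono linorder_not_le)
    then show ?thesis
      using b(1) unfolding less_maximal_function_iff m_def by auto
  qed
  then have "emeasure lborel {x. ennreal l < maximal_function w x}
      \<le> emeasure lborel {x. ennreal (l / 2) < maximal_function w' x}"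
    by (intro emeasure_mono) auto
  also have "\<dots> \<le> ennreal (5 ^ DIM('a) / (l / 2)) * (\<integral>\<^sup>+x. ennreal (w' x) \<partial>lborel)"
    using l by (intro maximal_function_weak_type) auto
  also have "(\<integral>\<^sup>+x. ennreal (w' x) \<partial>lborel) = (\<integral>\<^sup>+x. ennreal (w x) * indicator {..<2 * w x} l \<partial>lborel)"
    by (intro nn_integral_cong) (auto simp: w'_def split: split_indicator)
  finally show ?thesis by (simp add: mult.commute)
qed

text \<open>
  \<open>enn2real\<close> sends \<open>\<infinity>\<close> to \<open>0\<close>; nothing is lost for an integrable \<open>w\<close>,
  whose maximal function is finite almost everywhere.
\<close>

lemma maximal_function_strong_type:
  fixes u :: real
  assumes u: "u > 1"
  obtains C where "C > 0"
    "\<And>w :: 'a::euclidean_space \<Rightarrow> real. w \<in> borel_measurable borel \<Longrightarrow> (\<And>x. 0 \<le> w x) \<Longrightarrow>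
      (\<integral>\<^sup>+x. ennreal (enn2real (maximal_function w x) powr u) \<partial>lborel)
        \<le> ennreal C * (\<integral>\<^sup>+x. ennreal (w x powr u) \<partial>lborel)"
proof
  let ?A = "2 * 5 ^ DIM('a) :: real"
  \<comment> \<open>The layer-cake formula contributes \<open>u\<close>, the truncated weak type
    contributes \<open>?A / l\<close>, and after exchanging the integrals the integral of
    \<open>l powr (u - 2)\<close> over \<open>0 < l < 2 * w x\<close> gives
    \<open>(2 * w x) powr (u - 1) / (u - 1)\<close>; convergence at 0 is where u > 1 enters.\<close>
  define C where "C = u * ?A * (2 powr (u - 1) / (u - 1))"
  show "C > 0" using u by (simp add: C_def)
  fix w :: "'a \<Rightarrow> real" assume w[measurable]: "w \<in> borel_measurable borel" and nn: "\<And>x. 0 \<le> w x"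
  \<comment> \<open>Layer-cake formula, as an inequality only: where the maximal function is
    infinite, the left-hand side is 0 by the convention for \<open>enn2real\<close>.\<close>
  have "ennreal (enn2real (maximal_function w x) powr u)
      \<le> (\<integral>\<^sup>+l\<in>{0<..}. ennreal (u * l powr (u - 1)) * indicator {x. ennreal l < maximal_function w x} x \<partial>lborel)" for x
  proof -
    let ?y = "enn2real (maximal_function w x)"
    have "ennreal (?y powr u) = ennreal u * ennreal (?y powr u / u)"
      using u by (simp flip: ennreal_mult)
    also have "\<dots> = (\<integral>\<^sup>+l\<in>{0<..<?y}. ennreal (u * l powr (u - 1)) \<partial>lborel)"
      using u by (simp add: nn_integral_powr_from_0[symmetric] ennreal_mult mult.assoc nn_integral_cmult)
    also have "\<dots> \<le> (\<integral>\<^sup>+l\<in>{0<..}. ennreal (u * l powr (u - 1))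
        * indicator {x. ennreal l < maximal_function w x} x \<partial>lborel)"
    proof (intro nn_integral_mono)
      fix l :: real
      have "ennreal l < maximal_function w x" if "0 < l" "l < ?y"
        using that by (metis enn2real_top ennreal_enn2real_if ennreal_lessI less_le_trans less_asym
          infinity_ennreal_def less_le order_less_trans)
      then show "ennreal (u * l powr (u - 1)) * indicator {0<..<?y} l
          \<le> ennreal (u * l powr (u - 1)) * indicator {x. ennreal l < maximal_function w x} x * indicator {0<..} l"
        by (auto split: split_indicator)
    qed
    finally show ?thesis .
  qed
  then have "(\<integral>\<^sup>+x. ennreal (enn2real (maximal_function w x) powr u) \<partial>lborel) \<le>
     (\<integral>\<^sup>+x. (\<integral>\<^sup>+l\<in>{0<..}. ennreal (u * l powr (u - 1)) * indicator {x. ennreal l < maximal_function w x} x \<partial>lborel) \<partial>lborel)"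
    by (intro nn_integral_mono)
  also have "\<dots> = (\<integral>\<^sup>+l. (\<integral>\<^sup>+x. ennreal (u * l powr (u - 1)) * indicator {x. ennreal l < maximal_function w x} x * indicator {0<..} l \<partial>lborel) \<partial>lborel)"
    by (rule lborel_pair.Fubini') measurable
  also have "\<dots> = (\<integral>\<^sup>+l. ennreal (u * l powr (u - 1)) * indicator {0<..} l * emeasure lborel {x. ennreal l < maximal_function w x} \<partial>lborel)"
  proof (intro nn_integral_cong)
    fix l :: real
    have "(\<integral>\<^sup>+x. ennreal (u * l powr (u - 1)) * indicator {x. ennreal l < maximal_function w x} x * indicator {0<..} l \<partial>lborel)
      = (\<integral>\<^sup>+x. ennreal (u * l powr (u - 1)) * indicator {0<..} l * indicator {x. ennreal l < maximal_function w x} x \<partial>lborel)"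
      by (simp add: mult_ac)
    also have "\<dots> = ennreal (u * l powr (u - 1)) * indicator {0<..} l * emeasure lborel {x. ennreal l < maximal_function w x}"
      by (intro nn_integral_cmult_indicator) (simp add: open_maximal_function_superlevel)
    finally show "(\<integral>\<^sup>+x. ennreal (u * l powr (u - 1)) * indicator {x. ennreal l < maximal_function w x} x * indicator {0<..} l \<partial>lborel)
      = ennreal (u * l powr (u - 1)) * indicator {0<..} l * emeasure lborel {x. ennreal l < maximal_function w x}" .
  qed
  also have "\<dots> \<le> (\<integral>\<^sup>+l. (\<integral>\<^sup>+x. ennreal (u * ?A * w x) * (ennreal (l powr (u - 1 - 1)) * indicator {0<..<2 * w x} l) \<partial>lborel) \<partial>lborel)"
  proof (intro nn_integral_mono)
    fix l :: real
    show "ennreal (u * l powr (u - 1)) * indicator {0<..} l * emeasure lborel {x. ennreal l < maximal_function w x}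
      \<le> (\<integral>\<^sup>+x. ennreal (u * ?A * w x) * (ennreal (l powr (u - 1 - 1)) * indicator {0<..<2 * w x} l) \<partial>lborel)"
    proof (cases "l > 0")
      case l: True
      have "ennreal (u * l powr (u - 1)) * emeasure lborel {x. ennreal l < maximal_function w x}
         \<le> ennreal (u * l powr (u - 1)) * (ennreal (?A / l) * (\<integral>\<^sup>+x. ennreal (w x) * indicator {..<2 * w x} l \<partial>lborel))"
        using l by (intro mult_left_mono maximal_function_weak_type_truncated) auto
      also have "\<dots> = ennreal (u * l powr (u - 1) * (?A / l)) * (\<integral>\<^sup>+x. ennreal (w x) * indicator {..<2 * w x} l \<partial>lborel)"
        using l u by (subst (2) ennreal_mult) (auto simp: mult.assoc)
      also have "\<dots> = (\<integral>\<^sup>+x. ennreal (u * l powr (u - 1) * (?A / l)) * (ennreal (w x) * indicator {..<2 * w x} l) \<partial>lborel)"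
        by (intro nn_integral_cmult[symmetric]) (measurable; simp)
      also have "\<dots> = (\<integral>\<^sup>+x. ennreal (u * ?A * w x) * (ennreal (l powr (u - 1 - 1)) * indicator {0<..<2 * w x} l) \<partial>lborel)"
      proof (intro nn_integral_cong)
        fix x
        have "l powr (u - 1) = l powr (u - 1 - 1) * l"
          using l powr_add[of l "u - 1 - 1" 1] by simp
        then have "u * l powr (u - 1) * (?A / l) * w x = u * ?A * w x * l powr (u - 1 - 1)"
          using l by (simp add: field_simps)
        then show "ennreal (u * l powr (u - 1) * (?A / l)) * (ennreal (w x) * indicator {..<2 * w x} l)
            = ennreal (u * ?A * w x) * (ennreal (l powr (u - 1 - 1)) * indicator {0<..<2 * w x} l)"
          using l u nn[of x] by (auto split: split_indicator simp flip: ennreal_mult)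
      qed
      finally show ?thesis using l by simp
    qed simp
  qed
  also have "\<dots> = (\<integral>\<^sup>+x. (\<integral>\<^sup>+l. ennreal (u * ?A * w x) * (ennreal (l powr (u - 1 - 1)) * indicator {0<..<2 * w x} l) \<partial>lborel) \<partial>lborel)"
    by (rule lborel_pair.Fubini') (measurable; simp)
  also have "\<dots> = (\<integral>\<^sup>+x. ennreal C * ennreal (w x powr u) \<partial>lborel)"
  proof (intro nn_integral_cong)
    fix x
    have "(\<integral>\<^sup>+l. ennreal (u * ?A * w x) * (ennreal (l powr (u - 1 - 1)) * indicator {0<..<2 * w x} l) \<partial>lborel)
        = ennreal (u * ?A * w x) * ennreal ((2 * w x) powr (u - 1) / (u - 1))"
      using u nn[of x] nn_integral_powr_from_0[of "u - 1" "2 * w x"]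
      by (subst nn_integral_cmult) auto
    also have "\<dots> = ennreal (C * (w x * w x powr (u - 1)))"
      using u nn[of x] by (simp add: C_def powr_mult flip: ennreal_mult)
    also have "w x * w x powr (u - 1) = w x powr u"
      using nn[of x] powr_add[of "w x" 1 "u - 1"] by (cases "w x = 0") auto
    finally show "(\<integral>\<^sup>+l. ennreal (u * ?A * w x) * (ennreal (l powr (u - 1 - 1)) * indicator {0<..<2 * w x} l) \<partial>lborel)
        = ennreal C * ennreal (w x powr u)"
      using \<open>C > 0\<close> by (simp add: ennreal_mult)
  qed
  also have "\<dots> = ennreal C * (\<integral>\<^sup>+x. ennreal (w x powr u) \<partial>lborel)"
    by (intro nn_integral_cmult) measurable
  finally show "(\<integral>\<^sup>+x. ennreal (enn2real (maximal_function w x) powr u) \<partial>lborel)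
        \<le> ennreal C * (\<integral>\<^sup>+x. ennreal (w x powr u) \<partial>lborel)" .
qed

section \<open>Hedberg estimate and Morrey bounds for the maximal function\<close>

text \<open>For \<rho> below the threshold the bound \<open>near\<close> leaves
  \<open>\<rho> powr (\<alpha> - 1)\<close>, integrable at 0; above it \<open>far\<close> leaves
  \<open>\<rho> powr (\<alpha> - \<beta> - 1)\<close>, integrable at infinity. These integrals
  produce the terms \<open>1 / \<alpha>\<close> and \<open>1 / (\<beta> - \<alpha>)\<close>, and
  \<open>real DIM('a) - \<alpha>\<close> normalises the representation of the kernel.\<close>

lemma Riesz_potential_Hedberg:
  fixes F :: "'a::euclidean_space \<Rightarrow> real"
  assumes [measurable]: "F \<in> borel_measurable borel" and nn: "\<And>y. 0 \<le> F y"
    and \<alpha>: "0 < \<alpha>" "\<alpha> < \<beta>" "\<alpha> < real DIM('a)" and XY: "0 < X" "0 < Y"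
    and near: "\<And>\<rho>. \<rho> > 0 \<Longrightarrow> (\<integral>\<^sup>+y\<in>ball x \<rho>. ennreal (F y) \<partial>lborel) \<le> ennreal (X * \<rho> powr real DIM('a))"
    and far: "\<And>\<rho>. \<rho> > 0 \<Longrightarrow> (\<integral>\<^sup>+y\<in>ball x \<rho>. ennreal (F y) \<partial>lborel) \<le> ennreal (Y * \<rho> powr (real DIM('a) - \<beta>))"
  shows "(\<integral>\<^sup>+y. ennreal (F y * norm (x - y) powr (\<alpha> - real DIM('a))) \<partial>lborel)
    \<le> ennreal ((real DIM('a) - \<alpha>) * (1 / \<alpha> + 1 / (\<beta> - \<alpha>)) * X powr (1 - \<alpha> / \<beta>) * Y powr (\<alpha> / \<beta>))"
proof -
  define d where "d = real DIM('a)"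
  \<comment> \<open>The radius at which the two bounds agree:
    \<open>X * \<rho>0 powr d = Y * \<rho>0 powr (d - \<beta>)\<close>. Both pieces then become
    multiples of the same product of powers of \<open>X\<close> and \<open>Y\<close>.\<close>
  define \<rho>0 where "\<rho>0 = (Y / X) powr (1 / \<beta>)"
  have \<rho>0: "\<rho>0 > 0" using XY by (simp add: \<rho>0_def)
  have kernel: "ennreal (norm z powr (\<alpha> - d)) \<le>
      (\<integral>\<^sup>+\<rho>\<in>{norm z<..}. ennreal ((d - \<alpha>) * \<rho> powr (\<alpha> - d - 1)) \<partial>lborel)" for z :: 'a
  \<comment> \<open>At the origin the left-hand side is 0, since \<open>0 powr a = 0\<close>;
    elsewhere equality holds.\<close>
  proof (cases "z = 0")
    case False
    have "(\<integral>\<^sup>+\<rho>\<in>{norm z<..}. ennreal ((d - \<alpha>) * \<rho> powr (\<alpha> - d - 1)) \<partial>lborel)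
      = ennreal (d - \<alpha>) * (\<integral>\<^sup>+\<rho>\<in>{norm z<..}. ennreal (\<rho> powr (- (d - \<alpha>) - 1)) \<partial>lborel)"
      using \<alpha> by (subst nn_integral_cmult[symmetric]) (auto simp: d_def ennreal_mult mult.assoc)
    also have "\<dots> = ennreal (norm z powr (\<alpha> - d))"
      using \<alpha> False by (subst nn_integral_powr_to_infinity) (auto simp: d_def simp flip: ennreal_mult)
    finally show ?thesis by simp
  qed simp
  have "(\<integral>\<^sup>+y. ennreal (F y * norm (x - y) powr (\<alpha> - d)) \<partial>lborel) \<le>
      (\<integral>\<^sup>+y. (\<integral>\<^sup>+\<rho>. ennreal (F y) * (ennreal ((d - \<alpha>) * \<rho> powr (\<alpha> - d - 1)) * indicator {norm (x - y)<..} \<rho>) \<partial>lborel) \<partial>lborel)"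
    using nn
    by (intro nn_integral_mono, subst nn_integral_cmult) (auto simp: ennreal_mult intro!: mult_left_mono kernel)
  also have "\<dots> = (\<integral>\<^sup>+\<rho>. (\<integral>\<^sup>+y. ennreal (F y) * (ennreal ((d - \<alpha>) * \<rho> powr (\<alpha> - d - 1)) * indicator {norm (x - y)<..} \<rho>) \<partial>lborel) \<partial>lborel)"
    by (rule lborel_pair.Fubini') (measurable; simp)
  also have "\<dots> \<le> (\<integral>\<^sup>+\<rho>. ennreal ((d - \<alpha>) * X) * (ennreal (\<rho> powr (\<alpha> - 1)) * indicator {0<..<\<rho>0} \<rho>)
      + ennreal ((d - \<alpha>) * Y) * (ennreal (\<rho> powr (\<alpha> - \<beta> - 1)) * indicator {\<rho>0<..} \<rho>) \<partial>lborel)"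
  proof (rule nn_integral_mono_AE)
    \<comment> \<open>The threshold itself belongs to neither open interval and is discarded as a
      null set.\<close>
    have "AE \<rho> in lborel. \<rho> \<noteq> \<rho>0" by (rule AE_lborel_singleton)
    then show "AE \<rho> in lborel. (\<integral>\<^sup>+y. ennreal (F y) * (ennreal ((d - \<alpha>) * \<rho> powr (\<alpha> - d - 1)) * indicator {norm (x - y)<..} \<rho>) \<partial>lborel)
      \<le> ennreal ((d - \<alpha>) * X) * (ennreal (\<rho> powr (\<alpha> - 1)) * indicator {0<..<\<rho>0} \<rho>)
        + ennreal ((d - \<alpha>) * Y) * (ennreal (\<rho> powr (\<alpha> - \<beta> - 1)) * indicator {\<rho>0<..} \<rho>)"
    proof eventually_elim
      case (elim \<rho>)
      show ?case
      proof (cases "\<rho> > 0")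
        case pos: True
        have "(\<integral>\<^sup>+y. ennreal (F y) * (ennreal ((d - \<alpha>) * \<rho> powr (\<alpha> - d - 1)) * indicator {norm (x - y)<..} \<rho>) \<partial>lborel)
          = (\<integral>\<^sup>+y. ennreal ((d - \<alpha>) * \<rho> powr (\<alpha> - d - 1)) * (ennreal (F y) * indicator (ball x \<rho>) y) \<partial>lborel)"
          by (intro nn_integral_cong) (auto simp: dist_norm mult_ac split: split_indicator)
        also have "\<dots> = ennreal ((d - \<alpha>) * \<rho> powr (\<alpha> - d - 1)) * (\<integral>\<^sup>+y\<in>ball x \<rho>. ennreal (F y) \<partial>lborel)"
          by (rule nn_integral_cmult) (measurable; simp)
        finally have eq: "(\<integral>\<^sup>+y. ennreal (F y) * (ennreal ((d - \<alpha>) * \<rho> powr (\<alpha> - d - 1)) * indicator {norm (x - y)<..} \<rho>) \<partial>lborel)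
          = ennreal ((d - \<alpha>) * \<rho> powr (\<alpha> - d - 1)) * (\<integral>\<^sup>+y\<in>ball x \<rho>. ennreal (F y) \<partial>lborel)" .
        have "ennreal ((d - \<alpha>) * \<rho> powr (\<alpha> - d - 1)) * (\<integral>\<^sup>+y\<in>ball x \<rho>. ennreal (F y) \<partial>lborel)
            \<le> ennreal ((d - \<alpha>) * \<rho> powr (\<alpha> - d - 1)) * ennreal (X * \<rho> powr d)"
          using near[OF pos] by (intro mult_left_mono) (auto simp: d_def)
        also have "\<dots> = ennreal ((d - \<alpha>) * X) * ennreal (\<rho> powr (\<alpha> - 1))"
        proof -
          have "\<rho> powr (\<alpha> - d - 1) * \<rho> powr d = \<rho> powr (\<alpha> - 1)"
            by (simp flip: powr_add add: algebra_simps)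
          then show ?thesis
            using \<alpha> XY by (simp add: d_def mult_ac flip: ennreal_mult)
        qed
        finally have 1: "ennreal ((d - \<alpha>) * \<rho> powr (\<alpha> - d - 1)) * (\<integral>\<^sup>+y\<in>ball x \<rho>. ennreal (F y) \<partial>lborel)
          \<le> ennreal ((d - \<alpha>) * X) * ennreal (\<rho> powr (\<alpha> - 1))" .
        have "ennreal ((d - \<alpha>) * \<rho> powr (\<alpha> - d - 1)) * (\<integral>\<^sup>+y\<in>ball x \<rho>. ennreal (F y) \<partial>lborel)
            \<le> ennreal ((d - \<alpha>) * \<rho> powr (\<alpha> - d - 1)) * ennreal (Y * \<rho> powr (d - \<beta>))"
          using far[OF pos] by (intro mult_left_mono) (auto simp: d_def)
        also have "\<dots> = ennreal ((d - \<alpha>) * Y) * ennreal (\<rho> powr (\<alpha> - \<beta> - 1))"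
        proof -
          have "\<rho> powr (\<alpha> - d - 1) * \<rho> powr (d - \<beta>) = \<rho> powr (\<alpha> - \<beta> - 1)"
            by (simp flip: powr_add add: algebra_simps)
          then show ?thesis
            using \<alpha> XY by (simp add: d_def mult_ac flip: ennreal_mult)
        qed
        finally have 2: "ennreal ((d - \<alpha>) * \<rho> powr (\<alpha> - d - 1)) * (\<integral>\<^sup>+y\<in>ball x \<rho>. ennreal (F y) \<partial>lborel)
          \<le> ennreal ((d - \<alpha>) * Y) * ennreal (\<rho> powr (\<alpha> - \<beta> - 1))" .
        show ?thesis
          unfolding eq using 1 2 pos elim by (auto split: split_indicator)
      next
        case False
        then have "\<And>y. indicator {norm (x - y)<..} \<rho> = (0::ennreal)"
          by (auto split: split_indicator) (smt (verit) norm_ge_zero)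
        then show ?thesis by simp
      qed
    qed
  qed
  also have "\<dots> = ennreal ((d - \<alpha>) * X) * ennreal (\<rho>0 powr \<alpha> / \<alpha>)
      + ennreal ((d - \<alpha>) * Y) * ennreal (\<rho>0 powr (\<alpha> - \<beta>) / (\<beta> - \<alpha>))"
    using \<alpha> \<rho>0 nn_integral_powr_from_0[of \<alpha> \<rho>0] nn_integral_powr_to_infinity[of "\<beta> - \<alpha>" \<rho>0]
    by (subst nn_integral_add) (auto simp: nn_integral_cmult)
  also have "\<dots> = ennreal ((d - \<alpha>) * (X * \<rho>0 powr \<alpha> / \<alpha> + Y * \<rho>0 powr (\<alpha> - \<beta>) / (\<beta> - \<alpha>)))"
    using \<alpha> XY by (simp add: d_def distrib_left flip: ennreal_mult ennreal_plus)
  also have "X * \<rho>0 powr \<alpha> / \<alpha> + Y * \<rho>0 powr (\<alpha> - \<beta>) / (\<beta> - \<alpha>)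
      = (1 / \<alpha> + 1 / (\<beta> - \<alpha>)) * (X powr (1 - \<alpha> / \<beta>) * Y powr (\<alpha> / \<beta>))"
  proof -
    have X: "X * \<rho>0 powr \<alpha> = X powr (1 - \<alpha> / \<beta>) * Y powr (\<alpha> / \<beta>)"
      using XY by (simp add: \<rho>0_def powr_powr powr_divide powr_diff)
    have "Y * \<rho>0 powr (\<alpha> - \<beta>) = Y * (\<rho>0 powr \<alpha> / \<rho>0 powr \<beta>)"
      by (simp add: powr_diff)
    also have "\<rho>0 powr \<beta> = Y / X"
      using XY \<alpha> by (simp add: \<rho>0_def powr_powr)
    finally have "Y * \<rho>0 powr (\<alpha> - \<beta>) = X powr (1 - \<alpha> / \<beta>) * Y powr (\<alpha> / \<beta>)"
      using XY X by (simp add: mult.commute)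
    with X show ?thesis by (simp add: distrib_right)
  qed
  finally show ?thesis
    by (simp add: d_def mult.assoc)
qed

text \<open>Hoelder's inequality against the constant 1: a Morrey bound for the power
  \<open>u\<close> bounds the mean of \<open>v\<close> by
  \<open>(E * m powr (\<kappa> - 1)) powr (1 / u)\<close>, with \<open>m\<close> the volume. For u =
  1 the conjugate exponent is infinite, and the bound is the hypothesis itself.\<close>

lemma Morrey_ball_average:
  fixes v :: "'a::euclidean_space \<Rightarrow> real"
  assumes [measurable]: "v \<in> borel_measurable borel" and nn: "\<And>x. 0 \<le> v x"
    and u: "1 \<le> u" and E: "0 \<le> E" and R: "0 < R"
    and morrey: "(\<integral>\<^sup>+x\<in>ball c R. ennreal (v x powr u) \<partial>lborel) \<le> ennreal (E * measure lborel (ball c R) powr \<kappa>)"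
  shows "(\<integral>\<^sup>+x\<in>ball c R. ennreal (v x) \<partial>lborel)
    \<le> ennreal ((E * measure lborel (ball c R) powr (\<kappa> - 1)) powr (1 / u) * measure lborel (ball c R))"
proof -
  define m where "m = measure lborel (ball c R)"
  have m: "m > 0" using R by (simp add: m_def measure_ball_pos)
  show ?thesis
  proof (cases "u = 1")
    case True
    have "m powr (\<kappa> - 1) * m = m powr \<kappa>"
      using m by (simp add: powr_diff)
    then show ?thesis
      using morrey nn E True m by (simp add: mult.assoc flip: m_def)
  next
    case False
    then have u1: "u > 1" using u by simp
    define u' where "u' = u / (u - 1)"
    have u': "u' > 1" "1 / u + 1 / u' = 1" using u1 by (auto simp: u'_def field_simps)
    have [measurable]: "ball c R \<in> sets borel" by simp
    have "(\<integral>\<^sup>+x. ennreal (v x * indicator (ball c R) x * indicator (ball c R) x) \<partial>lborel)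
      \<le> ennreal ((E * m powr \<kappa>) powr (1 / u) * m powr (1 / u'))"
    proof (rule nn_integral_Holder[OF _ _ _ _ u1 u'])
      have "(\<integral>\<^sup>+x. ennreal ((v x * indicator (ball c R) x) powr u) \<partial>lborel)
          = (\<integral>\<^sup>+x\<in>ball c R. ennreal (v x powr u) \<partial>lborel)"
        by (intro nn_integral_cong) (auto split: split_indicator)
      then show "(\<integral>\<^sup>+x. ennreal ((v x * indicator (ball c R) x) powr u) \<partial>lborel)
          \<le> ennreal (((E * m powr \<kappa>) powr (1 / u)) powr u)"
        using morrey u1 E by (simp add: powr_powr m_def)
      have "(\<integral>\<^sup>+x. ennreal (indicator (ball c R) x powr u') \<partial>lborel) = (\<integral>\<^sup>+x. indicator (ball c R) x \<partial>lborel)"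
        by (intro nn_integral_cong) (auto split: split_indicator)
      then show "(\<integral>\<^sup>+x. ennreal (indicator (ball c R) x powr u') \<partial>lborel) \<le> ennreal ((m powr (1 / u')) powr u')"
        using u' m by (simp add: powr_powr emeasure_ball_measure m_def)
    qed (use nn m in auto)
    moreover have "(\<integral>\<^sup>+x. ennreal (v x * indicator (ball c R) x * indicator (ball c R) x) \<partial>lborel)
        = (\<integral>\<^sup>+x\<in>ball c R. ennreal (v x) \<partial>lborel)"
      by (intro nn_integral_cong) (auto split: split_indicator)
    moreover have "(E * m powr \<kappa>) powr (1 / u) * m powr (1 / u') = (E * m powr (\<kappa> - 1)) powr (1 / u) * m"
    proof -
      have eq: "1 / u' = 1 - 1 / u" using u' by simp
      show ?thesis
        unfolding eq using m E u1
        by (simp add: powr_mult powr_powr powr_divide diff_divide_distrib powr_diff)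
    qed
    ultimately show ?thesis by (simp add: m_def)
  qed
qed

text \<open>A ball of radius \<rho> \<le> R through \<open>x\<close> has all its points within R +
  2\<rho> \<le> 3R of \<open>c\<close>. A larger ball has a larger volume, and the Morrey bound for
  the mean decreases with the volume because \<kappa> < 1. Every ball falls into one of the two
  cases, hence a maximum and not a sum.\<close>

lemma maximal_function_Morrey_split:
  fixes v :: "'a::euclidean_space \<Rightarrow> real"
  assumes [measurable]: "v \<in> borel_measurable borel" and nn: "\<And>x. 0 \<le> v x"
    and u: "1 \<le> u" and E: "0 \<le> E" and R: "0 < R" and \<kappa>: "\<kappa> < 1" and x: "x \<in> ball c R"
    and morrey: "\<And>c R. R > 0 \<Longrightarrow>
      (\<integral>\<^sup>+x\<in>ball c R. ennreal (v x powr u) \<partial>lborel) \<le> ennreal (E * measure lborel (ball c R) powr \<kappa>)"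
  shows "maximal_function v x \<le> max (maximal_function (\<lambda>y. v y * indicator (ball c (3 * R)) y) x)
    (ennreal ((E * measure lborel (ball c R) powr (\<kappa> - 1)) powr (1 / u)))"
proof (rule ccontr)
  define v1 where "v1 y = v y * indicator (ball c (3 * R)) y" for y
  define L where "L = ennreal ((E * measure lborel (ball c R) powr (\<kappa> - 1)) powr (1 / u))"
  assume "\<not> ?thesis"
  then have "max (maximal_function v1 x) L < maximal_function v x"
    unfolding v1_def[abs_def] L_def by (simp only: not_le)
  then obtain c' \<rho> where b: "x \<in> ball c' \<rho>"
    "max (maximal_function v1 x) L * emeasure lborel (ball c' \<rho>) < (\<integral>\<^sup>+y\<in>ball c' \<rho>. ennreal (v y) \<partial>lborel)"
    unfolding less_maximal_function_iff by auto
  have \<rho>: "\<rho> > 0" using b(1) zero_le_dist[of c' x] unfolding mem_ball by linarith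
  show False
  proof (cases "\<rho> \<le> R")
    case True
    have sub: "y \<in> ball c (3 * R)" if "y \<in> ball c' \<rho>" for y
      using that b(1) x True dist_triangle[of c y c'] dist_triangle[of c c' x]
      by (simp add: dist_commute)
    have "(\<integral>\<^sup>+y\<in>ball c' \<rho>. ennreal (v y) \<partial>lborel) = (\<integral>\<^sup>+y\<in>ball c' \<rho>. ennreal (v1 y) \<partial>lborel)"
      using sub by (intro nn_integral_cong) (auto simp: v1_def split: split_indicator)
    also have "\<dots> \<le> maximal_function v1 x * emeasure lborel (ball c' \<rho>)"
      by (rule ball_average_le_maximal_function[OF b(1)])
    also have "\<dots> \<le> max (maximal_function v1 x) L * emeasure lborel (ball c' \<rho>)"
      by (intro mult_right_mono) auto
    finally show False using b(2) by simp
  next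
    case False
    let ?m = "measure lborel (ball c R)" and ?m' = "measure lborel (ball c' \<rho>)"
    have m: "?m > 0" "?m \<le> ?m'"
      using R False by (simp_all add: measure_ball_eq power_mono)
    have "(\<integral>\<^sup>+y\<in>ball c' \<rho>. ennreal (v y) \<partial>lborel) \<le> ennreal ((E * ?m' powr (\<kappa> - 1)) powr (1 / u) * ?m')"
      by (rule Morrey_ball_average[OF _ nn u E \<rho> morrey[OF \<rho>]]) simp
    also have "\<dots> \<le> ennreal ((E * ?m powr (\<kappa> - 1)) powr (1 / u) * ?m')"
      using m E u \<kappa>
      by (intro ennreal_leI mult_right_mono powr_mono2 mult_left_mono powr_mono2') auto
    also have "\<dots> = L * emeasure lborel (ball c' \<rho>)"
      by (simp add: L_def emeasure_ball_measure ennreal_mult)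
    also have "\<dots> \<le> max (maximal_function v1 x) L * emeasure lborel (ball c' \<rho>)"
      by (intro mult_right_mono) auto
    finally show False using b(2) by simp
  qed
qed

lemma measure_ball_triple: "R > 0 \<Longrightarrow>
    measure lborel (ball c (3 * R)) = 3 ^ DIM('a) * measure lborel (ball c R)"
  for c :: "'a::euclidean_space"
  by (simp add: measure_ball_eq power_mult_distrib)

text \<open>The local part contributes 15^n, that is 5^n from the covering lemma times 3^n, which
  majorises 3^(n\<kappa>) for the tripled ball. The constant part \<open>L\<close> contributes 1: it
  exceeds \<open>l\<close> either nowhere or on the whole ball, and in the second case the volume
  \<open>m\<close> is at most \<open>m * L / l = E * m powr \<kappa> / l\<close>.\<close>

lemma maximal_function_Morrey_weak_type:
  fixes v :: "'a::euclidean_space \<Rightarrow> real"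
  assumes [measurable]: "v \<in> borel_measurable borel" and nn: "\<And>x. 0 \<le> v x"
    and E: "0 \<le> E" and R: "0 < R" and \<kappa>: "0 < \<kappa>" "\<kappa> < 1" and l: "l > 0"
    and morrey: "\<And>c R. R > 0 \<Longrightarrow>
      (\<integral>\<^sup>+x\<in>ball c R. ennreal (v x) \<partial>lborel) \<le> ennreal (E * measure lborel (ball c R) powr \<kappa>)"
  shows "emeasure lborel {x \<in> ball c R. ennreal l < maximal_function v x}
    \<le> ennreal ((15 ^ DIM('a) + 1) * E * measure lborel (ball c R) powr \<kappa> / l)"
proof -
  define v1 where "v1 y = v y * indicator (ball c (3 * R)) y" for y
  define m where "m = measure lborel (ball c R)"
  define L where "L = E * m powr (\<kappa> - 1)"
  have m: "m > 0" using R by (simp add: m_def measure_ball_pos)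
  have L: "L \<ge> 0" using E by (simp add: L_def)
  have [measurable]: "ball c (3 * R) \<in> sets borel" by simp
  have [measurable]: "v1 \<in> borel_measurable borel" unfolding v1_def[abs_def] by measurable
  have morrey': "(\<integral>\<^sup>+x\<in>ball c R. ennreal (v x powr 1) \<partial>lborel)
      \<le> ennreal (E * measure lborel (ball c R) powr \<kappa>)" if "R > 0" for c R
    using morrey[OF that] nn by simp
  have le: "maximal_function v x \<le> max (maximal_function v1 x) (ennreal L)" if "x \<in> ball c R" for x
    using maximal_function_Morrey_split[OF _ nn order_refl E R \<kappa>(2) that morrey'] L
    by (simp add: v1_def[abs_def] L_def m_def)
  have "{x \<in> ball c R. ennreal l < maximal_function v x}
      \<subseteq> {x. ennreal l < maximal_function v1 x} \<union> {x \<in> ball c R. l < L}"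
    using le l by (fastforce simp: less_max_iff_disj ennreal_less_iff dest: order.strict_trans2)
  then have "emeasure lborel {x \<in> ball c R. ennreal l < maximal_function v x}
      \<le> emeasure lborel ({x. ennreal l < maximal_function v1 x} \<union> {x \<in> ball c R. l < L})"
    by (intro emeasure_mono) (auto simp: open_maximal_function_superlevel)
  also have "\<dots> \<le> emeasure lborel {x. ennreal l < maximal_function v1 x} + emeasure lborel {x \<in> ball c R. l < L}"
    by (intro emeasure_subadditive) (auto simp: open_maximal_function_superlevel)
  also have "\<dots> \<le> ennreal (15 ^ DIM('a) * E * m powr \<kappa> / l) + ennreal (E * m powr \<kappa> / l)"
  proof (intro add_mono)
    have "(\<integral>\<^sup>+x. ennreal (v1 x) \<partial>lborel) = (\<integral>\<^sup>+x\<in>ball c (3 * R). ennreal (v x) \<partial>lborel)"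
      by (intro nn_integral_cong) (auto simp: v1_def split: split_indicator)
    also have "\<dots> \<le> ennreal (E * (3 ^ DIM('a) * m) powr \<kappa>)"
      using morrey[of "3 * R" c] R by (simp add: measure_ball_triple m_def)
    also have "\<dots> \<le> ennreal (E * (3 ^ DIM('a) * m powr \<kappa>))"
    proof -
      have "(3 ^ DIM('a) :: real) powr \<kappa> \<le> (3 ^ DIM('a)) powr 1"
        using \<kappa> by (intro powr_mono) auto
      then show ?thesis
        using E m by (intro ennreal_leI mult_left_mono) (auto simp: powr_mult intro!: mult_right_mono)
    qed
    finally have v1: "(\<integral>\<^sup>+x. ennreal (v1 x) \<partial>lborel) \<le> ennreal (E * (3 ^ DIM('a) * m powr \<kappa>))" .
    have "emeasure lborel {x. ennreal l < maximal_function v1 x}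
        \<le> ennreal (5 ^ DIM('a) / l) * (\<integral>\<^sup>+x. ennreal (v1 x) \<partial>lborel)"
      using l by (intro maximal_function_weak_type) auto
    also have "\<dots> \<le> ennreal (5 ^ DIM('a) / l) * ennreal (E * (3 ^ DIM('a) * m powr \<kappa>))"
      by (rule mult_left_mono[OF v1]) simp
    also have "\<dots> = ennreal (5 ^ DIM('a) / l * (E * (3 ^ DIM('a) * m powr \<kappa>)))"
      using l E by (intro ennreal_mult[symmetric]) auto
    also have "5 ^ DIM('a) / l * (E * (3 ^ DIM('a) * m powr \<kappa>)) = 15 ^ DIM('a) * E * m powr \<kappa> / l"
      using power_mult_distrib[of 5 "3::real" "DIM('a)"] by simp
    finally show "emeasure lborel {x. ennreal l < maximal_function v1 x} \<le> ennreal (15 ^ DIM('a) * E * m powr \<kappa> / l)" .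
  next
    show "emeasure lborel {x \<in> ball c R. l < L} \<le> ennreal (E * m powr \<kappa> / l)"
    proof (cases "l < L")
      case True
      have "m * l \<le> m * L" using True m by simp
      also have "m * L = E * m powr \<kappa>" using m by (simp add: L_def powr_diff)
      finally have "m \<le> E * m powr \<kappa> / l" using l by (simp add: field_simps)
      moreover have "{x \<in> ball c R. l < L} = ball c R" using True by auto
      ultimately show ?thesis by (simp only: emeasure_ball_measure m_def ennreal_leI)
    qed simp
  qed
  also have "\<dots> = ennreal ((15 ^ DIM('a) + 1) * E * m powr \<kappa> / l)"
    using l E m by (simp add: distrib_right add_divide_distrib flip: ennreal_plus)
  finally show ?thesis by (simp add: m_def)
qed

text \<open>\<open>E\<close> stands for the p-th power of a norm bound. It is strictly positive so
  that quotients and thresholds formed from it make sense; vanishing norms are reached by a limit at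
  the very end.\<close>

definition Morrey_bounded :: "real \<Rightarrow> real \<Rightarrow> real \<Rightarrow> ('a::euclidean_space \<Rightarrow> real) \<Rightarrow> bool" where
  "Morrey_bounded p \<kappa> E v \<longleftrightarrow> v \<in> borel_measurable borel \<and> (\<forall>x. 0 \<le> v x) \<and> 0 < E \<and>
     (\<forall>c R. R > 0 \<longrightarrow> (\<integral>\<^sup>+x\<in>ball c R. ennreal (v x powr p) \<partial>lborel)
        \<le> ennreal (E * measure lborel (ball c R) powr \<kappa>))"

text \<open>A real majorant \<open>W\<close> replaces the maximal function, which may be infinite on
  a null set. Its positivity is what the pointwise potential estimate asks of its upper
  bound.\<close>

lemma maximal_function_Morrey_strong_type:
  fixes u \<kappa> :: real
  assumes u: "u > 1" and \<kappa>: "0 < \<kappa>" "\<kappa> < 1"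
  obtains C where "C > 0"
    "\<And>(v :: 'a::euclidean_space \<Rightarrow> real) E c R. Morrey_bounded u \<kappa> E v \<Longrightarrow> 0 < R \<Longrightarrow>
      \<exists>W \<in> borel_measurable borel. (\<forall>x. 0 < W x) \<and>
        (AE x in lborel. x \<in> ball c R \<longrightarrow> maximal_function v x \<le> ennreal (W x)) \<and>
        (\<integral>\<^sup>+x\<in>ball c R. ennreal (W x powr u) \<partial>lborel)
          \<le> ennreal (C * E * measure lborel (ball c R) powr \<kappa>)"
proof -
  obtain A where A: "A > 0"
    "\<And>w :: 'a \<Rightarrow> real. w \<in> borel_measurable borel \<Longrightarrow> (\<And>x. 0 \<le> w x) \<Longrightarrow>
      (\<integral>\<^sup>+x. ennreal (enn2real (maximal_function w x) powr u) \<partial>lborel)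
        \<le> ennreal A * (\<integral>\<^sup>+x. ennreal (w x powr u) \<partial>lborel)"
    using maximal_function_strong_type[OF u] by blast
  \<comment> \<open>The first term is the strong type on the tripled ball, with 3^(n\<kappa>) \<le>
    3^n; the 1 comes from the constant part, since
    \<open>L powr u * m = E * m powr \<kappa>\<close>.\<close>
  define C where "C = A * 3 ^ DIM('a) + 1"
  have C: "C > 0" using A by (simp add: C_def add_pos_nonneg)
  have main: "\<exists>W \<in> borel_measurable borel. (\<forall>x. 0 < W x) \<and>
        (AE x in lborel. x \<in> ball c R \<longrightarrow> maximal_function v x \<le> ennreal (W x)) \<and>
        (\<integral>\<^sup>+x\<in>ball c R. ennreal (W x powr u) \<partial>lborel)
          \<le> ennreal (C * E * measure lborel (ball c R) powr \<kappa>)"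
    if bounded: "Morrey_bounded u \<kappa> E v" and R: "0 < R"
    for v :: "'a \<Rightarrow> real" and E c R
  proof -
    have v[measurable]: "v \<in> borel_measurable borel" and nn: "\<And>x. 0 \<le> v x" and E: "0 < E"
      and morrey: "\<And>c R. R > 0 \<Longrightarrow> (\<integral>\<^sup>+x\<in>ball c R. ennreal (v x powr u) \<partial>lborel)
        \<le> ennreal (E * measure lborel (ball c R) powr \<kappa>)"
      using bounded by (auto simp: Morrey_bounded_def)
    define v1 where "v1 y = v y * indicator (ball c (3 * R)) y" for y
    define m where "m = measure lborel (ball c R)"
    define L where "L = (E * m powr (\<kappa> - 1)) powr (1 / u)"
    define W where "W x = max (enn2real (maximal_function v1 x)) L" for x
    have m: "m > 0" using R by (simp add: m_def measure_ball_pos)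
    have L: "L > 0" using E m by (simp add: L_def)
    have [measurable]: "ball c (3 * R) \<in> sets borel" "ball c R \<in> sets borel" by simp_all
    have [measurable]: "v1 \<in> borel_measurable borel" unfolding v1_def[abs_def] by measurable
    have [measurable]: "W \<in> borel_measurable borel" unfolding W_def[abs_def] by measurable
    have R3: "0 < 3 * R" using R by simp
    \<comment> \<open>Local integrability makes the maximal function of the truncation finite almost
      everywhere, so \<open>enn2real\<close> in \<open>W\<close> loses only a null set.\<close>
    have "(\<integral>\<^sup>+x\<in>ball c (3 * R). ennreal (v x) \<partial>lborel) < \<infinity>"
      by (rule order.strict_trans1[OF Morrey_ball_average[OF v nn less_imp_le[OF u] less_imp_le[OF E] R3 morrey[OF R3]]]) simp
    also have "(\<integral>\<^sup>+x\<in>ball c (3 * R). ennreal (v x) \<partial>lborel) = (\<integral>\<^sup>+x. ennreal (v1 x) \<partial>lborel)"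
      by (intro nn_integral_cong) (auto simp: v1_def split: split_indicator)
    finally have "AE x in lborel. maximal_function v1 x < \<infinity>"
      by (rule maximal_function_finite_AE[rotated]) measurable
    then have dom: "AE x in lborel. x \<in> ball c R \<longrightarrow> maximal_function v x \<le> ennreal (W x)"
    proof eventually_elim
      case (elim x)
      have "ennreal (W x) = max (maximal_function v1 x) (ennreal L)"
        using elim L
        by (cases "maximal_function v1 x") (auto simp: W_def max_def ennreal_le_iff)
      then show ?case
        using maximal_function_Morrey_split[OF v nn less_imp_le[OF u] less_imp_le[OF E] R \<kappa>(2) _ morrey]
        by (simp add: v1_def[abs_def] L_def m_def)
    qed
    have "(\<integral>\<^sup>+x\<in>ball c R. ennreal (W x powr u) \<partial>lborel)
      \<le> (\<integral>\<^sup>+x. ennreal (enn2real (maximal_function v1 x) powr u) + ennreal (L powr u) * indicator (ball c R) x \<partial>lborel)"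
      using u L by (intro nn_integral_mono) (auto simp: W_def max_def split: split_indicator simp flip: ennreal_plus)
    also have "\<dots> = (\<integral>\<^sup>+x. ennreal (enn2real (maximal_function v1 x) powr u) \<partial>lborel) + ennreal (L powr u) * ennreal m"
      by (subst nn_integral_add) (auto simp: nn_integral_cmult_indicator m_def emeasure_ball_measure)
    also have "\<dots> \<le> ennreal (A * (E * (3 ^ DIM('a) * m powr \<kappa>))) + ennreal (E * m powr \<kappa>)"
    proof (intro add_mono)
      have "(\<integral>\<^sup>+x. ennreal (enn2real (maximal_function v1 x) powr u) \<partial>lborel)
          \<le> ennreal A * (\<integral>\<^sup>+x. ennreal (v1 x powr u) \<partial>lborel)"
        using nn by (intro A) (auto simp: v1_def)
      also have "(\<integral>\<^sup>+x. ennreal (v1 x powr u) \<partial>lborel) = (\<integral>\<^sup>+x\<in>ball c (3 * R). ennreal (v x powr u) \<partial>lborel)"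
        by (intro nn_integral_cong) (auto simp: v1_def split: split_indicator)
      also have "\<dots> \<le> ennreal (E * (3 ^ DIM('a) * m) powr \<kappa>)"
        using morrey[OF R3, of c] R by (simp add: measure_ball_triple m_def)
      also have "\<dots> \<le> ennreal (E * (3 ^ DIM('a) * m powr \<kappa>))"
      proof -
        have "(3 ^ DIM('a) :: real) powr \<kappa> \<le> (3 ^ DIM('a)) powr 1"
          using \<kappa> by (intro powr_mono) auto
        then show ?thesis
          using E m by (intro ennreal_leI mult_left_mono) (auto simp: powr_mult intro!: mult_right_mono)
      qed
      finally show "(\<integral>\<^sup>+x. ennreal (enn2real (maximal_function v1 x) powr u) \<partial>lborel)
          \<le> ennreal (A * (E * (3 ^ DIM('a) * m powr \<kappa>)))"
        using A E by (simp add: mult_left_mono ennreal_mult)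
      have "L powr u * m = E * m powr \<kappa>"
        using u E m by (simp add: L_def powr_powr powr_diff)
      then show "ennreal (L powr u) * ennreal m \<le> ennreal (E * m powr \<kappa>)"
        using m by (simp flip: ennreal_mult)
    qed
    also have "\<dots> = ennreal (C * E * m powr \<kappa>)"
      using A E by (simp add: C_def algebra_simps flip: ennreal_plus)
    finally show ?thesis
      using dom L by (intro bexI[of _ W]) (auto simp: W_def m_def)
  qed
  show ?thesis by (rule that[OF C main])
qed

section \<open>The rough kernel\<close>

lemma completion_ex_borel_measurable_complex:
  fixes g :: "'a \<Rightarrow> complex"
  assumes [measurable]: "g \<in> borel_measurable (completion M)"
  obtains g' where "g' \<in> borel_measurable M" "AE x in M. g x = g' x"
proof -
  obtain a where a: "a \<in> borel_measurable M" "AE x in M. Re (g x) = a x"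
    using completion_ex_borel_measurable_real[of "\<lambda>x. Re (g x)" M] by auto
  obtain b where b: "b \<in> borel_measurable M" "AE x in M. Im (g x) = b x"
    using completion_ex_borel_measurable_real[of "\<lambda>x. Im (g x)" M] by auto
  show ?thesis
  proof (rule that)
    show "(\<lambda>x. of_real (a x) + \<i> * of_real (b x)) \<in> borel_measurable M"
      using a(1) b(1) by measurable
    show "AE x in M. g x = of_real (a x) + \<i> * of_real (b x)"
      using a(2) b(2) by eventually_elim (simp add: complex_eq_iff)
  qed
qed

lemma AE_lborel_affine:
  fixes t :: "'a::euclidean_space"
  assumes "c \<noteq> 0" "AE x in lborel. P x"
  shows "AE x in lborel. P (t + c *\<^sub>R x)"
proof -
  have "AE x in density (distr lborel borel (\<lambda>x. t + c *\<^sub>R x)) (\<lambda>_. \<bar>c\<bar>^DIM('a)). P x"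
    using assms by (subst lborel_affine[symmetric]) auto
  then have "AE x in distr lborel borel (\<lambda>x. t + c *\<^sub>R x). P x"
    using assms(1) by (simp add: AE_density)
  then show ?thesis
    by (rule AE_distrD[rotated]) measurable
qed

lemma nn_integral_lborel_affine:
  fixes t :: "'a::euclidean_space"
  assumes [measurable]: "f \<in> borel_measurable borel" and c: "c \<noteq> 0"
  shows "(\<integral>\<^sup>+x. f x \<partial>lborel) = ennreal (\<bar>c\<bar> ^ DIM('a)) * (\<integral>\<^sup>+x. f (t + c *\<^sub>R x) \<partial>lborel)"
  by (subst lborel_affine[OF c, of t])
     (simp add: nn_integral_density nn_integral_distr nn_integral_cmult)

lemma borel_measurable_sgn_euclidean [measurable]:
  "sgn \<in> borel_measurable (borel :: 'a::euclidean_space measure)"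
  unfolding sgn_div_norm[abs_def] by measurable

text \<open>The sphere carries the image under \<open>sgn\<close> of the uniform measure on the unit
  ball, so an exceptional set of directions pulls back to a null set there. Dilations spread this to
  the whole space, as they preserve both null sets and \<open>sgn\<close>.\<close>

lemma AE_sphere_measureD:
  fixes P :: "'a::euclidean_space \<Rightarrow> bool"
  assumes "AE x in sphere_measure. P x"
  shows "AE z in lborel. P (sgn z)"
proof -
  have "AE x in restrict_space (distr (uniform_measure lborel (ball 0 1)) borel sgn) (sphere 0 1). P x"
    using assms unfolding sphere_measure_def by (simp add: AE_completion_iff)
  then have "AE x in distr (uniform_measure lborel (ball 0 1)) borel sgn. x \<in> sphere 0 1 \<longrightarrow> P x"
    by (subst (asm) AE_restrict_space_iff) auto
  then have "AE z in uniform_measure lborel (ball 0 1). sgn z \<in> sphere 0 1 \<longrightarrow> P (sgn z)"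
    by (rule AE_distrD[rotated]) (simp add: borel_measurable_sgn_euclidean)
  moreover have "emeasure lborel (ball (0::'a) 1) \<noteq> 0"
    using measure_ball_pos[of 1 "0::'a"] by (simp add: emeasure_ball_measure)
  ultimately have unit: "AE z in lborel. z \<in> ball 0 1 \<longrightarrow> sgn z \<in> sphere 0 1 \<longrightarrow> P (sgn z)"
    by (subst (asm) AE_uniform_measure) (auto simp: emeasure_ball_measure)
  \<comment> \<open>Countably many dilations suffice: every point enters the unit ball after
    division by a large enough integer.\<close>
  have "AE z in lborel. \<forall>k. inverse (real (Suc k)) *\<^sub>R z \<in> ball 0 1 \<longrightarrow> sgn z \<in> sphere 0 1 \<longrightarrow> P (sgn z)"
    unfolding AE_all_countable
  proof
    fix k
    have "inverse (real (Suc k)) \<noteq> 0" by simp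
    from AE_lborel_affine[OF this unit, of 0]
    show "AE z in lborel. inverse (real (Suc k)) *\<^sub>R z \<in> ball 0 1 \<longrightarrow> sgn z \<in> sphere 0 1 \<longrightarrow> P (sgn z)"
      by (simp add: sgn_scaleR del: of_nat_Suc)
  qed
  moreover have "AE z in lborel. z \<noteq> (0::'a)" by (rule AE_lborel_singleton)
  ultimately show ?thesis
  proof eventually_elim
    case (elim z)
    obtain k where "norm z < real k" using reals_Archimedean2 by blast
    then have "inverse (real (Suc k)) *\<^sub>R z \<in> ball 0 1"
      by (simp add: field_simps)
    from elim(1)[rule_format, OF this] show ?case using elim(2) by (simp add: norm_sgn)
  qed
qed

text \<open>Turns the integrability of \<Omega> on the sphere into a volume integral over the unit
  ball without polar coordinates. The indicator of the sphere at \<open>sgn z\<close> differs from 1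
  only at the origin.\<close>

lemma nn_integral_sphere_measure:
  fixes F :: "'a::euclidean_space \<Rightarrow> ennreal"
  assumes [measurable]: "F \<in> borel_measurable borel"
  shows "(\<integral>\<^sup>+x. F x \<partial>sphere_measure) = (\<integral>\<^sup>+z\<in>ball 0 1. F (sgn z) \<partial>lborel) / emeasure lborel (ball (0::'a) 1)"
proof -
  have [measurable]: "sphere (0::'a) 1 \<in> sets borel" "ball (0::'a) 1 \<in> sets borel" by simp_all
  have "(\<integral>\<^sup>+x. F x \<partial>sphere_measure)
      = (\<integral>\<^sup>+x\<in>sphere 0 1. F x \<partial>distr (uniform_measure lborel (ball 0 1)) borel sgn)"
    unfolding sphere_measure_def nn_integral_completion
    by (subst nn_integral_restrict_space) auto
  also have "\<dots> = (\<integral>\<^sup>+z. F (sgn z) * indicator (sphere 0 1) (sgn z) \<partial>uniform_measure lborel (ball 0 1))"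
    by (rule nn_integral_distr) measurable
  also have "\<dots> = (\<integral>\<^sup>+z. F (sgn z) * indicator (sphere 0 1) (sgn z) * indicator (ball 0 1) z \<partial>lborel) / emeasure lborel (ball (0::'a) 1)"
    by (rule nn_integral_uniform_measure) measurable
  also have "(\<integral>\<^sup>+z. F (sgn z) * indicator (sphere 0 1) (sgn z) * indicator (ball 0 1) z \<partial>lborel)
      = (\<integral>\<^sup>+z\<in>ball 0 1. F (sgn z) \<partial>lborel)"
    using AE_lborel_singleton[of "0::'a"]
    by (intro nn_integral_cong_AE, elim eventually_mono) (auto simp: norm_sgn split: split_indicator)
  finally show ?thesis .
qed

text \<open>The hypothesis makes \<Omega> measurable only on the sphere. A Borel version there,
  composed with \<open>sgn\<close>, is Borel on the whole space and agrees with \<Omega> almost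
  everywhere by homogeneity.\<close>

lemma homogeneous_borel_version:
  fixes \<Omega> :: "'a::euclidean_space \<Rightarrow> complex"
  assumes \<Omega>: "\<Omega> \<in> borel_measurable sphere_measure" and hom: "homogeneous_degree_zero \<Omega>"
  obtains \<Lambda> where "\<Lambda> \<in> borel_measurable borel" "AE x in sphere_measure. \<Omega> x = \<Lambda> x"
    "AE z in lborel. \<Omega> z = \<Lambda> (sgn z)"
proof -
  let ?M = "restrict_space (distr (uniform_measure lborel (ball (0::'a) 1)) borel sgn) (sphere 0 1)"
  obtain \<Omega>' where \<Omega>': "\<Omega>' \<in> borel_measurable ?M" "AE x in ?M. \<Omega> x = \<Omega>' x"
    using completion_ex_borel_measurable_complex[OF \<Omega>[unfolded sphere_measure_def]] by blast
  \<comment> \<open>Extension by 0 off the sphere makes the representative Borel on the whole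
    space.\<close>
  define \<Lambda> where "\<Lambda> x = indicator (sphere 0 1) x *\<^sub>R \<Omega>' x" for x
  have "\<Lambda> \<in> borel_measurable (distr (uniform_measure lborel (ball (0::'a) 1)) borel sgn)"
    unfolding \<Lambda>_def[abs_def]
    by (subst borel_measurable_restrict_space_iff[symmetric]) (auto simp: \<Omega>'(1))
  then have meas: "\<Lambda> \<in> borel_measurable borel" by simp
  have "AE x in ?M. \<Omega> x = \<Lambda> x"
    using \<Omega>'(2) AE_space[of ?M] by eventually_elim (auto simp: \<Lambda>_def space_restrict_space)
  then have ae: "AE x in sphere_measure. \<Omega> x = \<Lambda> x"
    unfolding sphere_measure_def by (rule AE_completion)
  have "AE z in lborel. \<Omega> z = \<Lambda> (sgn z)"
    using AE_sphere_measureD[OF ae] AE_lborel_singleton[of "0::'a"]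
  proof eventually_elim
    case (elim z)
    have "\<Omega> (norm z *\<^sub>R sgn z) = \<Omega> (sgn z)"
      using hom elim unfolding homogeneous_degree_zero_def by (metis zero_less_norm_iff)
    then show ?case using elim by (simp add: sgn_div_norm)
  qed
  with meas ae show ?thesis by (rule that)
qed

lemma conjugate_exponent_cases:
  fixes s :: ennreal and s' :: real
  assumes "1 < s" "1 / s + 1 / ennreal s' = 1"
  obtains (infinite) "s = \<infinity>" "s' = 1"
    | (finite) S where "s = ennreal S" "1 < S" "1 < s'" "1 / S + 1 / s' = 1"
proof (cases s)
  case top
  then have "1 / ennreal s' = 1" using assms by simp
  then have "ennreal s' = 1" by (simp add: divide_eq_1_ennreal)
  then show ?thesis using top infinite by simp
next
  case (real S)
  have S: "S > 1" using assms(1) real by (simp add: ennreal_less_iff flip: ennreal_1)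
  have s': "s' > 0"
  proof (rule ccontr)
    assume "\<not> s' > 0"
    \<comment> \<open>For a nonpositive \<open>s'\<close> the coercion gives 0, and 1 / 0 is
      infinite in \<open>ennreal\<close>, against the sum being 1.\<close>
    then show False using assms(2) by (simp add: ennreal_neg)
  qed
  have "ennreal (1 / S + 1 / s') = 1 / s + 1 / ennreal s'"
    using S s' real divide_ennreal[of 1 S] divide_ennreal[of 1 s'] by simp
  then have eq: "1 / S + 1 / s' = 1"
    using assms(2) by (simp only: ennreal_eq_1)
  have "1 / S > 0" using S by simp
  then have "1 / s' < 1" using eq by linarith
  then have "s' > 1" using s' by (simp add: field_simps)
  then show ?thesis using finite real S eq by blast
qed

text \<open>\<open>W\<close> bounds the mean of \<open>h powr s'\<close> over the ball, and
  \<open>C\<close> is uniform in the centre and the radius. Later estimates of the potential use no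
  other size information on the kernel, so the cases s finite and s infinite are treated alike from
  here on.\<close>

definition local_Holder_kernel :: "real \<Rightarrow> real \<Rightarrow> ('a::euclidean_space \<Rightarrow> complex) \<Rightarrow> bool" where
  "local_Holder_kernel s' C \<Lambda> \<longleftrightarrow> \<Lambda> \<in> borel_measurable borel \<and> 0 < C \<and>
     (\<forall>h x R W. h \<in> borel_measurable borel \<longrightarrow> (\<forall>y. 0 \<le> h y) \<longrightarrow> 0 < R \<longrightarrow> 0 \<le> W \<longrightarrow>
       (\<integral>\<^sup>+y\<in>ball x R. ennreal (h y powr s') \<partial>lborel) \<le> ennreal (W * measure lborel (ball x R)) \<longrightarrow>
       (\<integral>\<^sup>+y\<in>ball x R. ennreal (norm (\<Lambda> (x - y)) * h y) \<partial>lborel)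
         \<le> ennreal (C * W powr (1 / s') * R powr real DIM('a)))"

text \<open>For infinite s an essential bound of the kernel is pulled out. For finite s this is
  Hoelder's inequality on the ball, where homogeneity makes the integral of |\<Lambda>|^s
  proportional to R^n; the powers of R from the two factors combine to R^n because 1/s + 1/s' =
  1.\<close>

lemma homogeneous_kernel_Holder:
  fixes \<Omega> :: "'a::euclidean_space \<Rightarrow> complex"
  assumes s: "1 < s" "1 / s + 1 / ennreal s' = 1"
    and \<Omega>: "\<Omega> \<in> Lp_space sphere_measure s" and hom: "homogeneous_degree_zero \<Omega>"
  obtains \<Lambda> C where "local_Holder_kernel s' C \<Lambda>" "AE z in lborel. \<Omega> z = \<Lambda> z"
proof -
  have meas: "\<Omega> \<in> borel_measurable sphere_measure" using \<Omega> by (simp add: Lp_space_def)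
  obtain \<Lambda>0 where \<Lambda>0[measurable]: "\<Lambda>0 \<in> borel_measurable borel" and
    ae_sphere: "AE x in sphere_measure. \<Omega> x = \<Lambda>0 x" and ae: "AE z in lborel. \<Omega> z = \<Lambda>0 (sgn z)"
    using homogeneous_borel_version[OF meas hom] by blast
  define \<Lambda> where "\<Lambda> z = \<Lambda>0 (sgn z)" for z
  have [measurable]: "\<Lambda> \<in> borel_measurable borel" unfolding \<Lambda>_def[abs_def] by measurable
  let ?\<omega> = "unit_ball_vol (real DIM('a))"
  have \<omega>: "?\<omega> > 0" by simp
  have vol: "measure lborel (ball x R) = ?\<omega> * R powr real DIM('a)" if "R > 0" for x :: 'a and R
    using that by (simp add: measure_ball_eq powr_realpow)
  have "\<exists>C>0. \<forall>h x R W. h \<in> borel_measurable borel \<longrightarrow> (\<forall>y. 0 \<le> h y) \<longrightarrow> 0 < R \<longrightarrow> 0 \<le> W \<longrightarrow>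
      (\<integral>\<^sup>+y\<in>ball x R. ennreal (h y powr s') \<partial>lborel) \<le> ennreal (W * measure lborel (ball x R)) \<longrightarrow>
      (\<integral>\<^sup>+y\<in>ball x R. ennreal (norm (\<Lambda> (x - y)) * h y) \<partial>lborel)
        \<le> ennreal (C * W powr (1 / s') * R powr real DIM('a))"
    (is "\<exists>C>0. ?P C")
    using s
  proof (cases rule: conjugate_exponent_cases)
    case infinite
    then obtain K where "AE x in sphere_measure. norm (\<Omega> x) \<le> K"
      using \<Omega> by (auto simp: Lp_space_def)
    with ae_sphere have "AE x in sphere_measure. norm (\<Lambda>0 x) \<le> max K 1"
      by eventually_elim auto
    then have bound: "AE z in lborel. norm (\<Lambda> z) \<le> max K 1"
      unfolding \<Lambda>_def by (rule AE_sphere_measureD)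
    show ?thesis
    proof (intro exI[of _ "max K 1 * ?\<omega>"] conjI allI impI)
      show "0 < max K 1 * ?\<omega>" using \<omega> by (intro mult_pos_pos) auto
      fix h :: "'a \<Rightarrow> real" and x R W
      assume [measurable]: "h \<in> borel_measurable borel" and nn: "\<forall>y. 0 \<le> h y" and R: "0 < R" and W: "0 \<le> W"
        and h: "(\<integral>\<^sup>+y\<in>ball x R. ennreal (h y powr s') \<partial>lborel) \<le> ennreal (W * measure lborel (ball x R))"
      have [measurable]: "ball x R \<in> sets borel" by simp
      have "AE y in lborel. norm (\<Lambda> (x - y)) \<le> max K 1"
        using AE_lborel_affine[OF _ bound, of "- 1" x] by simp
      then have "(\<integral>\<^sup>+y\<in>ball x R. ennreal (norm (\<Lambda> (x - y)) * h y) \<partial>lborel)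
          \<le> (\<integral>\<^sup>+y. ennreal (max K 1) * (ennreal (h y powr s') * indicator (ball x R) y) \<partial>lborel)"
        using infinite nn
        by (intro nn_integral_mono_AE, elim eventually_mono)
          (auto split: split_indicator simp flip: ennreal_mult intro!: ennreal_leI mult_right_mono)
      also have "\<dots> = ennreal (max K 1) * (\<integral>\<^sup>+y\<in>ball x R. ennreal (h y powr s') \<partial>lborel)"
        by (rule nn_integral_cmult) measurable
      also have "\<dots> \<le> ennreal (max K 1) * ennreal (W * measure lborel (ball x R))"
        by (intro mult_left_mono h) simp
      also have "\<dots> = ennreal (max K 1 * ?\<omega> * W powr (1 / s') * R powr real DIM('a))"
        using infinite W vol[OF R, of x] by (simp add: mult_ac flip: ennreal_mult)
      finally show "(\<integral>\<^sup>+y\<in>ball x R. ennreal (norm (\<Lambda> (x - y)) * h y) \<partial>lborel)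
          \<le> ennreal (max K 1 * ?\<omega> * W powr (1 / s') * R powr real DIM('a))" .
    qed
  next
    case (finite S)
    have "(\<integral>\<^sup>+x. ennreal (norm (\<Omega> x) powr S) \<partial>sphere_measure) < \<infinity>"
      using \<Omega> finite by (auto simp: Lp_space_def)
    also have "(\<integral>\<^sup>+x. ennreal (norm (\<Omega> x) powr S) \<partial>sphere_measure)
        = (\<integral>\<^sup>+x. ennreal (norm (\<Lambda>0 x) powr S) \<partial>sphere_measure)"
      using ae_sphere by (intro nn_integral_cong_AE, elim eventually_mono) simp
    also have "\<dots> = (\<integral>\<^sup>+z\<in>ball 0 1. ennreal (norm (\<Lambda> z) powr S) \<partial>lborel) / emeasure lborel (ball (0::'a) 1)"
      unfolding \<Lambda>_def by (rule nn_integral_sphere_measure) measurable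
    finally have "(\<integral>\<^sup>+z\<in>ball 0 1. ennreal (norm (\<Lambda> z) powr S) \<partial>lborel) < \<infinity>"
      using measure_ball_pos[of 1 "0::'a"]
      by (auto simp: less_top[symmetric] ennreal_divide_eq_top_iff emeasure_ball_measure)
    then obtain Q0 where Q0: "(\<integral>\<^sup>+z\<in>ball 0 1. ennreal (norm (\<Lambda> z) powr S) \<partial>lborel) = ennreal Q0" "Q0 \<ge> 0"
      by (cases "\<integral>\<^sup>+z\<in>ball 0 1. ennreal (norm (\<Lambda> z) powr S) \<partial>lborel") auto
    \<comment> \<open>Adding 1 keeps the constant positive even when the kernel vanishes almost
      everywhere.\<close>
    define Q where "Q = Q0 + 1"
    have Q: "Q > 0" using Q0 by (simp add: Q_def)
    have kernel: "(\<integral>\<^sup>+y\<in>ball x R. ennreal (norm (\<Lambda> (x - y)) powr S) \<partial>lborel) \<le> ennreal (Q * R powr real DIM('a))"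
      if R: "R > 0" for x R
    proof -
      have [measurable]: "ball x R \<in> sets borel" by simp
      \<comment> \<open>The substitution y = x - Rz maps the unit ball onto \<open>ball x R\<close>
        with Jacobian R^n, and \<open>\<Lambda> (R *\<^sub>R z) = \<Lambda> z\<close>.\<close>
      have "(\<integral>\<^sup>+y\<in>ball x R. ennreal (norm (\<Lambda> (x - y)) powr S) \<partial>lborel)
        = ennreal (\<bar>- R\<bar> ^ DIM('a)) * (\<integral>\<^sup>+z. ennreal (norm (\<Lambda> (x - (x + (- R) *\<^sub>R z))) powr S)
            * indicator (ball x R) (x + (- R) *\<^sub>R z) \<partial>lborel)"
        by (rule nn_integral_lborel_affine[rotated]) (use R in simp, measurable)
      also have "(\<integral>\<^sup>+z. ennreal (norm (\<Lambda> (x - (x + (- R) *\<^sub>R z))) powr S)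
            * indicator (ball x R) (x + (- R) *\<^sub>R z) \<partial>lborel)
          = (\<integral>\<^sup>+z\<in>ball 0 1. ennreal (norm (\<Lambda> z) powr S) \<partial>lborel)"
        using R by (intro nn_integral_cong)
          (auto simp: \<Lambda>_def sgn_scaleR dist_norm split: split_indicator)
      finally show ?thesis
        using R Q0 by (simp add: Q_def powr_realpow mult.commute mult_left_mono flip: ennreal_mult)
    qed
    define C where "C = Q powr (1 / S) * ?\<omega> powr (1 / s')"
    show ?thesis
    proof (intro exI[of _ C] conjI allI impI)
      show "0 < C"
        unfolding C_def using Q less_imp_neq[OF \<omega>] by (intro mult_pos_pos) auto
      fix h :: "'a \<Rightarrow> real" and x R W
      assume [measurable]: "h \<in> borel_measurable borel" and nn: "\<forall>y. 0 \<le> h y" and R: "0 < R" and W: "0 \<le> W"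
        and h: "(\<integral>\<^sup>+y\<in>ball x R. ennreal (h y powr s') \<partial>lborel) \<le> ennreal (W * measure lborel (ball x R))"
      have [measurable]: "ball x R \<in> sets borel" by simp
      define m where "m = W * measure lborel (ball x R)"
      have m: "m \<ge> 0" using W by (simp add: m_def)
      let ?i = "indicator (ball x R) :: 'a \<Rightarrow> real"
      have "(\<integral>\<^sup>+y. ennreal ((norm (\<Lambda> (x - y)) * ?i y) * (h y * ?i y)) \<partial>lborel)
          \<le> ennreal ((Q * R powr real DIM('a)) powr (1 / S) * m powr (1 / s'))"
      proof (rule nn_integral_Holder[OF _ _ _ _ finite(2-4)])
        have "(\<integral>\<^sup>+y. ennreal ((norm (\<Lambda> (x - y)) * ?i y) powr S) \<partial>lborel)
            = (\<integral>\<^sup>+y\<in>ball x R. ennreal (norm (\<Lambda> (x - y)) powr S) \<partial>lborel)"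
          by (intro nn_integral_cong) (auto split: split_indicator)
        then show "(\<integral>\<^sup>+y. ennreal ((norm (\<Lambda> (x - y)) * ?i y) powr S) \<partial>lborel)
            \<le> ennreal (((Q * R powr real DIM('a)) powr (1 / S)) powr S)"
          using kernel[OF R, of x] finite Q by (simp add: powr_powr)
        have "(\<integral>\<^sup>+y. ennreal ((h y * ?i y) powr s') \<partial>lborel)
            = (\<integral>\<^sup>+y\<in>ball x R. ennreal (h y powr s') \<partial>lborel)"
          by (intro nn_integral_cong) (auto split: split_indicator)
        then show "(\<integral>\<^sup>+y. ennreal ((h y * ?i y) powr s') \<partial>lborel) \<le> ennreal ((m powr (1 / s')) powr s')"
          using h finite m by (simp add: powr_powr m_def)
      qed (use nn in auto)
      also have "(\<integral>\<^sup>+y. ennreal ((norm (\<Lambda> (x - y)) * ?i y) * (h y * ?i y)) \<partial>lborel)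
          = (\<integral>\<^sup>+y\<in>ball x R. ennreal (norm (\<Lambda> (x - y)) * h y) \<partial>lborel)"
        by (intro nn_integral_cong) (auto split: split_indicator)
      also have "(Q * R powr real DIM('a)) powr (1 / S) * m powr (1 / s')
          = C * W powr (1 / s') * (R powr real DIM('a)) powr (1 / S + 1 / s')"
        unfolding m_def vol[OF R] C_def powr_add
        using Q W \<omega> by (simp add: powr_mult mult_ac del: powr_powr)
      also have "(R powr real DIM('a)) powr (1 / S + 1 / s') = R powr real DIM('a)"
        using finite R by simp
      finally show "(\<integral>\<^sup>+y\<in>ball x R. ennreal (norm (\<Lambda> (x - y)) * h y) \<partial>lborel)
          \<le> ennreal (C * W powr (1 / s') * R powr real DIM('a))" .
    qed
  qed
  then obtain C where "C > 0" "?P C" by blast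
  then have "local_Holder_kernel s' C \<Lambda>" by (simp add: local_Holder_kernel_def)
  moreover have "AE z in lborel. \<Omega> z = \<Lambda> z" using ae by (simp add: \<Lambda>_def)
  ultimately show ?thesis by (rule that)
qed

section \<open>Morrey norms and products\<close>

lemma ennreal_powr_ennreal: "0 \<le> x \<Longrightarrow> ennreal_powr (ennreal x) a = ennreal (x powr a)"
  by (simp add: ennreal_powr_def)

lemma emeasure_lebesgue_ball: "emeasure lebesgue (ball c R) = ennreal (measure lborel (ball c R))"
  for c :: "'a::euclidean_space"
  by (simp add: emeasure_ball_measure)

text \<open>With its converse below, this moves between the norm, with its quotients and roots in
  \<open>ennreal\<close>, and integral bounds on single balls with real constants, where all
  estimates take place.\<close>

lemma morrey_norm_leD:
  fixes f :: "'a::euclidean_space \<Rightarrow> complex"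
  assumes le: "morrey_norm p \<kappa> f \<le> ennreal a" and p: "p > 0" and R: "R > 0" and a: "0 \<le> a"
  shows "(\<integral>\<^sup>+x\<in>ball c R. ennreal (norm (f x) powr p) \<partial>lebesgue)
    \<le> ennreal (a powr p * measure lborel (ball c R) powr \<kappa>)"
proof -
  define m where "m = measure lborel (ball c R) powr \<kappa>"
  define I where "I = (\<integral>\<^sup>+x\<in>ball c R. ennreal (norm (f x) powr p) \<partial>lebesgue)"
  have m: "m > 0" using measure_ball_pos[OF R, of c] by (simp add: m_def)
  have "ennreal_powr (I / ennreal m) (1 / p) \<le> morrey_norm p \<kappa> f"
    unfolding morrey_norm_def I_def m_def
    by (rule SUP_upper2[of "(c, R)"]) (use R in \<open>auto simp: emeasure_lebesgue_ball ennreal_powr_ennreal\<close>)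
  with le have le': "ennreal_powr (I / ennreal m) (1 / p) \<le> ennreal a" by simp
  show ?thesis
  proof (cases I)
    case top
    then show ?thesis using le' by (simp add: ennreal_powr_def ennreal_top_divide top_unique)
  next
    case (real i)
    then have "(i / m) powr (1 / p) \<le> a"
      using le' m a by (simp add: divide_ennreal ennreal_powr_ennreal)
    then have "((i / m) powr (1 / p)) powr p \<le> a powr p"
      using p by (intro powr_mono2) auto
    then have "i \<le> a powr p * m"
      using p m real by (simp add: powr_powr field_simps)
    then show ?thesis using real by (simp add: I_def m_def ennreal_leI)
  qed
qed

lemma morrey_norm_leI:
  fixes f :: "'a::euclidean_space \<Rightarrow> complex"
  assumes p: "p > 0" and D: "0 \<le> D"
    and le: "\<And>c R. R > 0 \<Longrightarrow> (\<integral>\<^sup>+x\<in>ball c R. ennreal (norm (f x) powr p) \<partial>lebesgue)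
      \<le> ennreal (D powr p * measure lborel (ball c R) powr \<kappa>)"
  shows "morrey_norm p \<kappa> f \<le> ennreal D"
  unfolding morrey_norm_def
proof (intro SUP_least, clarsimp simp: emeasure_lebesgue_ball ennreal_powr_ennreal)
  fix c :: 'a and R :: real assume R: "R > 0"
  define m where "m = measure lborel (ball c R) powr \<kappa>"
  define I where "I = (\<integral>\<^sup>+x\<in>ball c R. ennreal (norm (f x) powr p) \<partial>lebesgue)"
  have m: "m > 0" using measure_ball_pos[OF R, of c] by (simp add: m_def)
  have "I \<le> ennreal (D powr p * m)" using le[OF R, of c] by (simp add: I_def m_def)
  then obtain i where i: "I = ennreal i" "i \<ge> 0" "i \<le> D powr p * m"
    using m by (cases I) (auto simp: top_unique)
  then have "(i / m) powr (1 / p) \<le> (D powr p) powr (1 / p)"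
    using m p by (intro powr_mono2) (auto simp: field_simps)
  also have "\<dots> = D" using p D by (simp add: powr_powr)
  finally show "ennreal_powr (I / ennreal m) (1 / p) \<le> ennreal D"
    using i m by (simp add: divide_ennreal ennreal_powr_ennreal ennreal_leI)
qed

lemma weak_morrey_norm_leI:
  fixes f :: "'a::euclidean_space \<Rightarrow> complex"
  assumes p: "p > 0" and D: "0 \<le> D"
    and le: "\<And>c R t. R > 0 \<Longrightarrow> t > 0 \<Longrightarrow> emeasure lebesgue {x \<in> ball c R. t < norm (f x)}
      \<le> ennreal ((D / t) powr p * measure lborel (ball c R) powr \<kappa>)"
  shows "weak_morrey_norm p \<kappa> f \<le> ennreal D"
  unfolding weak_morrey_norm_def
proof (intro SUP_least, clarsimp simp: emeasure_lebesgue_ball ennreal_powr_ennreal simp del: mem_ball)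
  fix c :: 'a and R :: real assume R: "R > 0"
  define m where "m = measure lborel (ball c R)"
  have m: "m > 0" using measure_ball_pos[OF R, of c] by (simp add: m_def)
  have "ennreal t * ennreal_powr (emeasure lebesgue {x \<in> ball c R. t < norm (f x)}) (1 / p)
      \<le> ennreal (D * m powr (\<kappa> / p))" if t: "t > 0" for t
  proof -
    define I where "I = emeasure lebesgue {x \<in> ball c R. t < norm (f x)}"
    have "I \<le> ennreal ((D / t) powr p * m powr \<kappa>)" using le[OF R t, of c] by (simp add: I_def m_def)
    then obtain i where i: "I = ennreal i" "i \<ge> 0" "i \<le> (D / t) powr p * m powr \<kappa>"
      using m by (cases I) (auto simp: top_unique)
    then have "i powr (1 / p) \<le> ((D / t) powr p * m powr \<kappa>) powr (1 / p)"
      using p by (intro powr_mono2) auto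
    also have "\<dots> = D / t * m powr (\<kappa> / p)" using p D t by (simp add: powr_mult powr_powr)
    finally have "t * i powr (1 / p) \<le> D * m powr (\<kappa> / p)" using t by (simp add: field_simps)
    then show ?thesis
      using i t by (simp add: I_def[symmetric] ennreal_powr_ennreal ennreal_leI del: mem_ball flip: ennreal_mult)
  qed
  then have "(SUP t\<in>{0<..}. ennreal t * ennreal_powr (emeasure lebesgue {x \<in> ball c R. t < norm (f x)}) (1 / p))
      \<le> ennreal (D * m powr (\<kappa> / p))"
    by (intro SUP_least) auto
  then have "(SUP t\<in>{0<..}. ennreal t * ennreal_powr (emeasure lebesgue {x \<in> ball c R. t < norm (f x)}) (1 / p))
      / ennreal (m powr (\<kappa> / p)) \<le> ennreal (D * m powr (\<kappa> / p)) / ennreal (m powr (\<kappa> / p))"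
    by (rule divide_right_mono_ennreal)
  also have "\<dots> = ennreal D" using m D by (simp add: divide_ennreal)
  finally show "(SUP t\<in>{0<..}. ennreal t * ennreal_powr (emeasure lebesgue {x \<in> ball c R. t < norm (f x)}) (1 / p))
      / ennreal (measure lborel (ball c R) powr (\<kappa> / p)) \<le> ennreal D"
    by (simp add: m_def)
qed

text \<open>Hoelder's inequality with exponents p/r and t/r. Both factors carry the same
  \<open>m\<close>, a power \<kappa> of the volume in the application, and its exponents r/p and r/t
  add up to 1; so \<kappa> is inherited by the product.\<close>

lemma nn_integral_powr_product_le:
  fixes f g :: "'a \<Rightarrow> complex"
  assumes [measurable]: "f \<in> borel_measurable M" "g \<in> borel_measurable M" "B \<in> sets M"
    and exps: "0 < r" "0 < p" "0 < t" "1 / p + 1 / t = 1 / r" and nn: "0 \<le> a" "0 \<le> b" "0 \<le> m"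
    and f: "(\<integral>\<^sup>+x\<in>B. ennreal (norm (f x) powr p) \<partial>M) \<le> ennreal (a powr p * m)"
    and g: "(\<integral>\<^sup>+x\<in>B. ennreal (norm (g x) powr t) \<partial>M) \<le> ennreal (b powr t * m)"
  shows "(\<integral>\<^sup>+x\<in>B. ennreal (norm (f x * g x) powr r) \<partial>M) \<le> ennreal ((a * b) powr r * m)"
proof -
  have "(\<integral>\<^sup>+x\<in>B. ennreal (norm (f x * g x) powr r) \<partial>M)
      = (\<integral>\<^sup>+x. ennreal ((norm (f x) powr r * indicator B x) * (norm (g x) powr r * indicator B x)) \<partial>M)"
    by (intro nn_integral_cong) (auto simp: norm_mult powr_mult split: split_indicator)
  also have "\<dots> \<le> ennreal ((a powr p * m) powr (r / p) * (b powr t * m) powr (r / t))"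
  proof (rule nn_integral_Holder)
    have pt: "1 / p < 1 / r" "1 / t < 1 / r" using exps by (auto simp flip: exps(4))
    then show "1 < p / r" "1 < t / r" using exps by (auto simp: field_simps)
    have "1 / (p / r) + 1 / (t / r) = r * (1 / p + 1 / t)" by (simp add: field_simps)
    then show "1 / (p / r) + 1 / (t / r) = 1" using exps by simp
    have "(\<integral>\<^sup>+x. ennreal ((norm (f x) powr r * indicator B x) powr (p / r)) \<partial>M)
        = (\<integral>\<^sup>+x\<in>B. ennreal (norm (f x) powr p) \<partial>M)"
      using exps by (intro nn_integral_cong) (auto simp: powr_powr split: split_indicator)
    then show "(\<integral>\<^sup>+x. ennreal ((norm (f x) powr r * indicator B x) powr (p / r)) \<partial>M)
        \<le> ennreal (((a powr p * m) powr (r / p)) powr (p / r))"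
      using f exps nn by (simp add: powr_powr)
    have "(\<integral>\<^sup>+x. ennreal ((norm (g x) powr r * indicator B x) powr (t / r)) \<partial>M)
        = (\<integral>\<^sup>+x\<in>B. ennreal (norm (g x) powr t) \<partial>M)"
      using exps by (intro nn_integral_cong) (auto simp: powr_powr split: split_indicator)
    then show "(\<integral>\<^sup>+x. ennreal ((norm (g x) powr r * indicator B x) powr (t / r)) \<partial>M)
        \<le> ennreal (((b powr t * m) powr (r / t)) powr (t / r))"
      using g exps nn by (simp add: powr_powr)
  qed (use nn in auto)
  also have "(a powr p * m) powr (r / p) * (b powr t * m) powr (r / t)
      = (a * b) powr r * (m powr (r / p) * m powr (r / t))"
    using nn exps by (simp add: powr_mult powr_powr)
  also have "m powr (r / p) * m powr (r / t) = m"
  proof -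
    have "r / p + r / t = r * (1 / p + 1 / t)" by (simp add: distrib_left)
    also have "\<dots> = 1" using exps by simp
    finally show ?thesis using nn by (simp flip: powr_add)
  qed
  finally show ?thesis .
qed

section \<open>Superlevel sets and products in weak spaces\<close>

lemma sets_norm_superlevel:
  fixes f :: "'a \<Rightarrow> complex"
  assumes [measurable]: "f \<in> borel_measurable M" "B \<in> sets M"
  shows "{x \<in> B. l < norm (f x)} \<in> sets M"
proof -
  have "{x \<in> B. l < norm (f x)} = B \<inter> {x \<in> space M. l < norm (f x)}"
    using sets.sets_into_space[OF assms(2)] by auto
  also have "\<dots> \<in> sets M" by measurable
  finally show ?thesis .
qed

text \<open>Chebyshev's inequality; it brings factors with a strong bound into the form that the
  weak product estimate expects.\<close>

lemma emeasure_superlevel_le: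
  fixes f :: "'a \<Rightarrow> complex"
  assumes [measurable]: "f \<in> borel_measurable M" "B \<in> sets M"
    and p: "0 < p" and l: "0 < l" and nn: "0 \<le> a" "0 \<le> m"
    and f: "(\<integral>\<^sup>+x\<in>B. ennreal (norm (f x) powr p) \<partial>M) \<le> ennreal (a powr p * m)"
  shows "emeasure M {x \<in> B. l < norm (f x)} \<le> ennreal ((a / l) powr p * m)"
proof -
  have [measurable]: "{x \<in> B. l < norm (f x)} \<in> sets M"
    by (rule sets_norm_superlevel) measurable
  have "emeasure M {x \<in> B. l < norm (f x)} = (\<integral>\<^sup>+x. indicator {x \<in> B. l < norm (f x)} x \<partial>M)" by simp
  also have "\<dots> \<le> (\<integral>\<^sup>+x. ennreal (1 / l powr p) * (ennreal (norm (f x) powr p) * indicator B x) \<partial>M)"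
    using l p
    by (intro nn_integral_mono) (auto split: split_indicator simp flip: ennreal_mult ennreal_1
      simp: field_simps intro!: powr_mono2)
  also have "\<dots> = ennreal (1 / l powr p) * (\<integral>\<^sup>+x\<in>B. ennreal (norm (f x) powr p) \<partial>M)"
    by (rule nn_integral_cmult) measurable
  also have "\<dots> \<le> ennreal (1 / l powr p) * ennreal (a powr p * m)"
    by (intro mult_left_mono f) simp
  also have "\<dots> = ennreal ((a / l) powr p * m)"
    using l nn by (simp add: powr_divide flip: ennreal_mult)
  finally show ?thesis .
qed

text \<open>If |fg| > l, then |f| > \<mu> or |g| > l/\<mu>, for any \<mu> > 0. With \<mu> chosen to
  balance the two bounds, each is \<open>z powr r * m\<close>, and the factor 2 of their sum becomes
  \<open>2 powr (1 / r)\<close> inside the power.\<close>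

lemma emeasure_superlevel_product_le:
  fixes f g :: "'a \<Rightarrow> complex"
  assumes [measurable]: "f \<in> borel_measurable M" "g \<in> borel_measurable M" "B \<in> sets M"
    and exps: "0 < r" "0 < p" "0 < t" "1 / p + 1 / t = 1 / r"
    and pos: "0 < a" "0 < b" "0 \<le> m" "0 < l"
    and f: "\<And>l. 0 < l \<Longrightarrow> emeasure M {x \<in> B. l < norm (f x)} \<le> ennreal ((a / l) powr p * m)"
    and g: "\<And>l. 0 < l \<Longrightarrow> emeasure M {x \<in> B. l < norm (g x)} \<le> ennreal ((b / l) powr t * m)"
  shows "emeasure M {x \<in> B. l < norm (f x * g x)} \<le> ennreal ((2 powr (1 / r) * a * b / l) powr r * m)"
proof -
  define z where "z = a * b / l"
  \<comment> \<open>The solution of \<open>(a / \<mu>) powr p = z powr r\<close>; the exponent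
    relation then gives the same value for the other factor.\<close>
  define \<mu> where "\<mu> = a / z powr (r / p)"
  have z: "z > 0" using pos by (simp add: z_def)
  have \<mu>: "\<mu> > 0" using pos z by (simp add: \<mu>_def)
  have [measurable]: "{x \<in> B. \<mu> < norm (f x)} \<in> sets M" "{x \<in> B. l / \<mu> < norm (g x)} \<in> sets M"
    by (simp_all add: sets_norm_superlevel assms(1-3))
  have "{x \<in> B. l < norm (f x * g x)} \<subseteq> {x \<in> B. \<mu> < norm (f x)} \<union> {x \<in> B. l / \<mu> < norm (g x)}"
  proof safe
    fix x assume x: "l < norm (f x * g x)" "\<not> l / \<mu> < norm (g x)"
    show "\<mu> < norm (f x)"
    proof (rule ccontr)
      assume "\<not> \<mu> < norm (f x)"
      then have "norm (f x) * norm (g x) \<le> \<mu> * (l / \<mu>)"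
        using x \<mu> by (intro mult_mono) auto
      then show False using x \<mu> by (simp add: norm_mult)
    qed
  qed
  then have "emeasure M {x \<in> B. l < norm (f x * g x)}
      \<le> emeasure M ({x \<in> B. \<mu> < norm (f x)} \<union> {x \<in> B. l / \<mu> < norm (g x)})"
    by (intro emeasure_mono) auto
  also have "\<dots> \<le> emeasure M {x \<in> B. \<mu> < norm (f x)} + emeasure M {x \<in> B. l / \<mu> < norm (g x)}"
    by (intro emeasure_subadditive) auto
  also have "\<dots> \<le> ennreal ((a / \<mu>) powr p * m) + ennreal ((b / (l / \<mu>)) powr t * m)"
    using \<mu> pos by (intro add_mono f g) auto
  also have "(a / \<mu>) powr p = z powr r"
    using pos z exps by (simp add: \<mu>_def powr_powr)
  also have "(b / (l / \<mu>)) powr t = z powr r"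
  proof -
    have "b / (l / \<mu>) = z powr (1 - r / p)"
      using pos z by (simp add: \<mu>_def powr_diff) (simp add: z_def mult.commute)
    moreover have "(1 - r / p) * t = r"
    proof -
      have "1 - r / p = r * (1 / r - 1 / p)" using exps by (simp add: field_simps)
      also have "1 / r - 1 / p = 1 / t" using exps by simp
      finally show ?thesis using exps by simp
    qed
    ultimately show ?thesis by (simp add: powr_powr)
  qed
  also have "ennreal (z powr r * m) + ennreal (z powr r * m) = ennreal ((2 powr (1 / r) * a * b / l) powr r * m)"
  proof -
    have "2 powr (1 / r) * a * b / l = 2 powr (1 / r) * z" by (simp add: z_def)
    then have "(2 powr (1 / r) * a * b / l) powr r = 2 * z powr r"
      using z exps by (simp add: powr_mult powr_powr)
    then show ?thesis using pos by (simp flip: ennreal_plus)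
  qed
  finally show ?thesis .
qed

lemma borel_measurable_completion_AE:
  fixes f g :: "'a \<Rightarrow> 'b::topological_space"
  assumes g: "g \<in> borel_measurable M" and ae: "AE x in M. f x = g x"
  shows "f \<in> borel_measurable (completion M)"
proof (rule measurableI)
  fix A :: "'b set" assume A: "A \<in> sets borel"
  show "f -` A \<inter> space (completion M) \<in> sets (completion M)"
  proof (rule completion.in_sets_AE)
    show "AE x in completion M. x \<in> g -` A \<inter> space M \<longleftrightarrow> x \<in> f -` A \<inter> space (completion M)"
      using AE_completion[OF ae] by eventually_elim auto
    show "g -` A \<inter> space M \<in> sets (completion M)"
      using measurable_sets[OF g A] by simp
  qed auto
qed auto

section \<open>Rough fractional integrals on Morrey spaces\<close>

text \<open>The operator with absolute values inside: it is finite precisely where the integral for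
  the kernel \<Lambda> and a function of modulus \<open>h\<close> converges absolutely.\<close>

definition rough_potential :: "('a::euclidean_space \<Rightarrow> complex) \<Rightarrow> real \<Rightarrow> ('a \<Rightarrow> real) \<Rightarrow> 'a \<Rightarrow> ennreal" where
  "rough_potential \<Lambda> \<alpha> h x =
     (\<integral>\<^sup>+y. ennreal (norm (\<Lambda> (x - y)) * h y * norm (x - y) powr (\<alpha> - real DIM('a))) \<partial>lborel)"

lemma borel_measurable_rough_potential [measurable]:
  assumes [measurable]: "\<Lambda> \<in> borel_measurable borel" "h \<in> borel_measurable borel"
  shows "rough_potential \<Lambda> \<alpha> h \<in> borel_measurable borel"
  unfolding rough_potential_def[abs_def] by measurable

text \<open>\<beta> is the decay rate in the radius of the L^q means that a Morrey bound provides,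
  and \<alpha>/\<beta> is the exponent \<theta>. The last assumption is Adams' relation between
  \<open>q\<close> and \<open>t\<close>, rewritten in the form in which powers are compared.\<close>

locale Morrey_exponents =
  fixes \<Lambda> :: "'a::euclidean_space \<Rightarrow> complex" and C0 s' q t \<alpha> \<beta> \<kappa> :: real
  assumes kernel: "local_Holder_kernel s' C0 \<Lambda>"
    and s': "1 \<le> s'" "s' \<le> q" and \<alpha>: "0 < \<alpha>" "\<alpha> < real DIM('a)" and \<kappa>: "0 < \<kappa>" "\<kappa> < 1"
    and \<beta>: "\<beta> = real DIM('a) * (1 - \<kappa>) / q" "\<alpha> < \<beta>"
    and t: "0 < t" "(1 - \<alpha> / \<beta>) * t = q"
begin

lemma pos: "0 < q" "0 < \<beta>" "0 < s'" "0 < 1 - \<alpha> / \<beta>"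
  using s' \<alpha> \<beta>(2) by auto

lemma \<Lambda>_borel [measurable]: "\<Lambda> \<in> borel_measurable borel" and C0: "C0 > 0"
  using kernel by (simp_all add: local_Holder_kernel_def)

lemma kernel_le:
  "h \<in> borel_measurable borel \<Longrightarrow> (\<And>y. 0 \<le> h y) \<Longrightarrow> 0 < R \<Longrightarrow> 0 \<le> W \<Longrightarrow>
    (\<integral>\<^sup>+y\<in>ball x R. ennreal (h y powr s') \<partial>lborel) \<le> ennreal (W * measure lborel (ball x R)) \<Longrightarrow>
    (\<integral>\<^sup>+y\<in>ball x R. ennreal (norm (\<Lambda> (x - y)) * h y) \<partial>lborel)
      \<le> ennreal (C0 * W powr (1 / s') * R powr real DIM('a))"
  using kernel by (simp add: local_Holder_kernel_def)

text \<open>\<open>W\<close> is any positive upper bound at the single point \<open>x\<close>: the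
  strong case inserts a majorant defined almost everywhere, the weak case a fixed level.\<close>

lemma pointwise_bound:
  obtains C where "C > 0"
    "\<And>h b x W. Morrey_bounded q \<kappa> (b powr q) h \<Longrightarrow> 0 < b \<Longrightarrow>
      0 < W \<Longrightarrow> maximal_function (\<lambda>y. h y powr s') x \<le> ennreal W \<Longrightarrow>
      rough_potential \<Lambda> \<alpha> h x \<le> ennreal (C * W powr ((1 - \<alpha> / \<beta>) / s') * b powr (\<alpha> / \<beta>))"
proof -
  let ?\<omega> = "unit_ball_vol (real DIM('a))"
  have \<omega>: "?\<omega> > 0" by simp
  define A where "A = (real DIM('a) - \<alpha>) * (1 / \<alpha> + 1 / (\<beta> - \<alpha>))"
  have A: "A > 0" using \<alpha> \<beta>(2) by (simp add: A_def add_pos_pos)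
  \<comment> \<open>The constant part of the volume of a ball, raised to the power (\<kappa>-1)/q in
    which the volume enters the far bound.\<close>
  define e where "e = ?\<omega> powr ((\<kappa> - 1) / q)"
  have e: "e > 0" using less_imp_neq[OF \<omega>] by (simp add: e_def)
  define C where "C = A * C0 * e powr (\<alpha> / \<beta>)"
  have C: "C > 0" using A C0 e by (simp add: C_def)
  have main: "rough_potential \<Lambda> \<alpha> h x \<le> ennreal (C * W powr ((1 - \<alpha> / \<beta>) / s') * b powr (\<alpha> / \<beta>))"
    if bounded: "Morrey_bounded q \<kappa> (b powr q) h" and b: "0 < b" and W: "0 < W" and max: "maximal_function (\<lambda>y. h y powr s') x \<le> ennreal W"
    for h :: "'a \<Rightarrow> real" and b x W
  proof -
    have h[measurable]: "h \<in> borel_measurable borel" and nn: "\<And>y. 0 \<le> h y"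
      and morrey: "\<And>c R. R > 0 \<Longrightarrow> (\<integral>\<^sup>+y\<in>ball c R. ennreal (h y powr q) \<partial>lborel)
        \<le> ennreal (b powr q * measure lborel (ball c R) powr \<kappa>)"
      using bounded by (auto simp: Morrey_bounded_def)
    define X where "X = C0 * W powr (1 / s')"
    define Y where "Y = C0 * (b * e)"
    have "(\<integral>\<^sup>+y. ennreal (norm (\<Lambda> (x - y)) * h y * norm (x - y) powr (\<alpha> - real DIM('a))) \<partial>lborel)
      \<le> ennreal ((real DIM('a) - \<alpha>) * (1 / \<alpha> + 1 / (\<beta> - \<alpha>)) * X powr (1 - \<alpha> / \<beta>) * Y powr (\<alpha> / \<beta>))"
    proof (rule Riesz_potential_Hedberg[OF _ _ \<alpha>(1) \<beta>(2) \<alpha>(2)])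
      show "0 < X" "0 < Y" using C0 W b e by (simp_all add: X_def Y_def)
      fix \<rho> :: real assume \<rho>: "\<rho> > 0"
      have x: "x \<in> ball x \<rho>" using \<rho> by simp
      have "(\<integral>\<^sup>+y\<in>ball x \<rho>. ennreal (h y powr s') \<partial>lborel)
          \<le> maximal_function (\<lambda>y. h y powr s') x * emeasure lborel (ball x \<rho>)"
        by (rule ball_average_le_maximal_function[OF x])
      also have "\<dots> \<le> ennreal W * emeasure lborel (ball x \<rho>)"
        by (intro mult_right_mono max) simp
      also have "\<dots> = ennreal (W * measure lborel (ball x \<rho>))"
        using W by (simp add: emeasure_ball_measure ennreal_mult)
      finally show "(\<integral>\<^sup>+y\<in>ball x \<rho>. ennreal (norm (\<Lambda> (x - y)) * h y) \<partial>lborel) \<le> ennreal (X * \<rho> powr real DIM('a))"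
        unfolding X_def using nn \<rho> W by (intro kernel_le) auto
      let ?m = "measure lborel (ball x \<rho>)"
      \<comment> \<open>The bound for the mean of \<open>h powr s'\<close> from the Morrey bound
        with exponent q/s'; its root of order s' decays like \<rho>^(-\<beta>).\<close>
      let ?W = "(b powr q * ?m powr (\<kappa> - 1)) powr (1 / (q / s'))"
      have m: "?m > 0" using \<rho> by (rule measure_ball_pos)
      have "(\<integral>\<^sup>+y\<in>ball x \<rho>. ennreal (h y powr s') \<partial>lborel) \<le> ennreal (?W * ?m)"
      proof (rule Morrey_ball_average)
        show "(\<integral>\<^sup>+y\<in>ball x \<rho>. ennreal ((h y powr s') powr (q / s')) \<partial>lborel) \<le> ennreal (b powr q * ?m powr \<kappa>)"
          using morrey[OF \<rho>, of x] pos by (simp add: powr_powr)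
      qed (use s' \<rho> in auto)
      then have "(\<integral>\<^sup>+y\<in>ball x \<rho>. ennreal (norm (\<Lambda> (x - y)) * h y) \<partial>lborel)
          \<le> ennreal (C0 * ?W powr (1 / s') * \<rho> powr real DIM('a))"
        using nn \<rho> by (intro kernel_le) auto
      also have "?W powr (1 / s') = b * ?m powr ((\<kappa> - 1) / q)"
        using pos b m by (simp add: powr_powr powr_mult)
      also have "?m powr ((\<kappa> - 1) / q) = e * \<rho> powr (- \<beta>)"
      proof -
        have "?m = ?\<omega> * \<rho> powr real DIM('a)"
          using \<rho> by (simp add: measure_ball_eq powr_realpow)
        moreover have "real DIM('a) * ((\<kappa> - 1) / q) = - \<beta>"
          unfolding \<beta>(1) using pos by (simp add: field_simps)
        ultimately show ?thesis
          using \<omega> by (simp add: e_def powr_mult powr_powr del: times_divide_eq_right)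
      qed
      also have "C0 * (b * (e * \<rho> powr (- \<beta>))) * \<rho> powr real DIM('a) = Y * \<rho> powr (real DIM('a) - \<beta>)"
        using \<rho> by (simp add: Y_def powr_diff powr_minus field_simps)
      finally show "(\<integral>\<^sup>+y\<in>ball x \<rho>. ennreal (norm (\<Lambda> (x - y)) * h y) \<partial>lborel)
          \<le> ennreal (Y * \<rho> powr (real DIM('a) - \<beta>))" .
    qed (use nn in auto)
    also have "(real DIM('a) - \<alpha>) * (1 / \<alpha> + 1 / (\<beta> - \<alpha>)) * X powr (1 - \<alpha> / \<beta>) * Y powr (\<alpha> / \<beta>)
        = C * W powr ((1 - \<alpha> / \<beta>) / s') * b powr (\<alpha> / \<beta>)"
    proof -
      let ?w = "W powr ((1 - \<alpha> / \<beta>) / s')"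
      have X: "X powr (1 - \<alpha> / \<beta>) = C0 powr (1 - \<alpha> / \<beta>) * ?w"
        using C0 W by (simp add: X_def powr_mult powr_powr)
      have Y: "Y powr (\<alpha> / \<beta>) = C0 powr (\<alpha> / \<beta>) * b powr (\<alpha> / \<beta>) * e powr (\<alpha> / \<beta>)"
        using C0 b e by (simp add: Y_def powr_mult)
      have "A * X powr (1 - \<alpha> / \<beta>) * Y powr (\<alpha> / \<beta>)
          = A * (C0 powr (1 - \<alpha> / \<beta>) * C0 powr (\<alpha> / \<beta>)) * e powr (\<alpha> / \<beta>) * ?w * b powr (\<alpha> / \<beta>)"
        unfolding X Y by (simp only: mult_ac)
      also have "C0 powr (1 - \<alpha> / \<beta>) * C0 powr (\<alpha> / \<beta>) = C0"
        using C0 by (simp flip: powr_add)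
      finally show ?thesis unfolding A_def C_def .
    qed
    finally show ?thesis unfolding rough_potential_def .
  qed
  show ?thesis by (rule that[OF C main])
qed

lemma strong_bound:
  assumes less: "s' < q"
  obtains C where "C > 0"
    "\<And>h b c R. Morrey_bounded q \<kappa> (b powr q) h \<Longrightarrow> 0 < b \<Longrightarrow> R > 0 \<Longrightarrow>
      (AE x in lborel. x \<in> ball c R \<longrightarrow> rough_potential \<Lambda> \<alpha> h x < \<infinity>) \<and>
      (\<integral>\<^sup>+x\<in>ball c R. ennreal (enn2real (rough_potential \<Lambda> \<alpha> h x) powr t) \<partial>lborel)
        \<le> ennreal ((C * b) powr t * measure lborel (ball c R) powr \<kappa>)"
proof -
  define u where "u = q / s'"
  have u: "u > 1" using less pos by (simp add: u_def)
  obtain C1 where C1: "C1 > 0"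
    "\<And>h b x W. Morrey_bounded q \<kappa> (b powr q) h \<Longrightarrow> 0 < b \<Longrightarrow>
      0 < W \<Longrightarrow> maximal_function (\<lambda>y. h y powr s') x \<le> ennreal W \<Longrightarrow>
      rough_potential \<Lambda> \<alpha> h x \<le> ennreal (C1 * W powr ((1 - \<alpha> / \<beta>) / s') * b powr (\<alpha> / \<beta>))"
    using pointwise_bound by blast
  obtain C2 where C2: "C2 > 0"
    "\<And>(v :: 'a \<Rightarrow> real) E c R. Morrey_bounded u \<kappa> E v \<Longrightarrow> 0 < R \<Longrightarrow>
      \<exists>W \<in> borel_measurable borel. (\<forall>x. 0 < W x) \<and>
        (AE x in lborel. x \<in> ball c R \<longrightarrow> maximal_function v x \<le> ennreal (W x)) \<and>
        (\<integral>\<^sup>+x\<in>ball c R. ennreal (W x powr u) \<partial>lborel)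
          \<le> ennreal (C2 * E * measure lborel (ball c R) powr \<kappa>)"
    using maximal_function_Morrey_strong_type[OF u \<kappa>] by blast
  \<comment> \<open>The t-th power of the pointwise bound contains \<open>W x powr u\<close>, whose
    integral brings the factor \<open>C2\<close>; since C appears inside a t-th power, its root is
    taken. The powers of b combine by (\<alpha>/\<beta>)t + q = t.\<close>
  define C where "C = C1 * C2 powr (1 / t)"
  have C: "C > 0" using C1 C2 by (simp add: C_def)
  have main: "(AE x in lborel. x \<in> ball c R \<longrightarrow> rough_potential \<Lambda> \<alpha> h x < \<infinity>) \<and>
      (\<integral>\<^sup>+x\<in>ball c R. ennreal (enn2real (rough_potential \<Lambda> \<alpha> h x) powr t) \<partial>lborel)
        \<le> ennreal ((C * b) powr t * measure lborel (ball c R) powr \<kappa>)"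
    if bounded: "Morrey_bounded q \<kappa> (b powr q) h" and b: "0 < b" and R: "R > 0"
    for h :: "'a \<Rightarrow> real" and b c R
  proof -
    have h[measurable]: "h \<in> borel_measurable borel" and nn: "\<And>y. 0 \<le> h y"
      and morrey: "\<And>c R. R > 0 \<Longrightarrow> (\<integral>\<^sup>+y\<in>ball c R. ennreal (h y powr q) \<partial>lborel)
        \<le> ennreal (b powr q * measure lborel (ball c R) powr \<kappa>)"
      using bounded by (auto simp: Morrey_bounded_def)
    have [measurable]: "ball c R \<in> sets borel" by simp
    have "\<exists>W \<in> borel_measurable borel. (\<forall>x. 0 < W x) \<and>
        (AE x in lborel. x \<in> ball c R \<longrightarrow> maximal_function (\<lambda>y. h y powr s') x \<le> ennreal (W x)) \<and>
        (\<integral>\<^sup>+x\<in>ball c R. ennreal (W x powr u) \<partial>lborel)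
          \<le> ennreal (C2 * b powr q * measure lborel (ball c R) powr \<kappa>)"
      using bounded R pos by (intro C2(2)) (auto simp: Morrey_bounded_def powr_powr u_def)
    then obtain W where [measurable]: "W \<in> borel_measurable borel" and W: "\<And>x. 0 < W x"
        "AE x in lborel. x \<in> ball c R \<longrightarrow> maximal_function (\<lambda>y. h y powr s') x \<le> ennreal (W x)"
        "(\<integral>\<^sup>+x\<in>ball c R. ennreal (W x powr u) \<partial>lborel)
          \<le> ennreal (C2 * b powr q * measure lborel (ball c R) powr \<kappa>)"
      by blast
    define Z where "Z x = C1 * W x powr ((1 - \<alpha> / \<beta>) / s') * b powr (\<alpha> / \<beta>)" for x
    have bound: "AE x in lborel. x \<in> ball c R \<longrightarrow> rough_potential \<Lambda> \<alpha> h x \<le> ennreal (Z x)"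
      using W(2)
    proof eventually_elim
      case (elim x)
      show ?case
        unfolding Z_def using C1(2)[OF bounded b W(1)] elim by blast
    qed
    then have fin: "AE x in lborel. x \<in> ball c R \<longrightarrow> rough_potential \<Lambda> \<alpha> h x < \<infinity>"
      by eventually_elim (auto intro: order.strict_trans1)
    have Zt: "Z x powr t = C1 powr t * b powr (\<alpha> / \<beta> * t) * W x powr u" for x
    proof -
      have "(1 - \<alpha> / \<beta>) / s' * t = u" unfolding u_def t(2)[symmetric] by simp
      then show ?thesis
        using C1(1) b W(1)[of x] by (simp add: Z_def powr_mult powr_powr mult_ac)
    qed
    have "(\<integral>\<^sup>+x\<in>ball c R. ennreal (enn2real (rough_potential \<Lambda> \<alpha> h x) powr t) \<partial>lborel)
      \<le> (\<integral>\<^sup>+x. ennreal (C1 powr t * b powr (\<alpha> / \<beta> * t)) * (ennreal (W x powr u) * indicator (ball c R) x) \<partial>lborel)"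
      using bound
    proof (intro nn_integral_mono_AE, eventually_elim)
      case (elim x)
      show ?case
      proof (cases "x \<in> ball c R")
        case True
        have "Z x \<ge> 0" using C1(1) by (simp add: Z_def)
        then have "enn2real (rough_potential \<Lambda> \<alpha> h x) \<le> Z x"
          using elim True by (intro enn2real_leI) auto
        then have "enn2real (rough_potential \<Lambda> \<alpha> h x) powr t \<le> Z x powr t"
          using t by (intro powr_mono2) auto
        then show ?thesis
          using True by (simp add: Zt ennreal_leI flip: ennreal_mult)
      qed simp
    qed
    also have "\<dots> = ennreal (C1 powr t * b powr (\<alpha> / \<beta> * t)) * (\<integral>\<^sup>+x\<in>ball c R. ennreal (W x powr u) \<partial>lborel)"
      by (rule nn_integral_cmult) measurable
    also have "\<dots> \<le> ennreal (C1 powr t * b powr (\<alpha> / \<beta> * t)) * ennreal (C2 * b powr q * measure lborel (ball c R) powr \<kappa>)"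
      by (intro mult_left_mono W) simp
    also have "\<dots> = ennreal (C1 powr t * b powr (\<alpha> / \<beta> * t) * (C2 * b powr q * measure lborel (ball c R) powr \<kappa>))"
      using C2(1) by (intro ennreal_mult[symmetric]) auto
    also have "C1 powr t * b powr (\<alpha> / \<beta> * t) * (C2 * b powr q * measure lborel (ball c R) powr \<kappa>)
        = (C * b) powr t * measure lborel (ball c R) powr \<kappa>"
    proof -
      have "\<alpha> / \<beta> * t + q = t" unfolding t(2)[symmetric] by (simp add: left_diff_distrib)
      then have "b powr (\<alpha> / \<beta> * t) * b powr q = b powr t" by (simp flip: powr_add)
      moreover have "(C * b) powr t = C1 powr t * C2 * b powr t"
        using C1(1) C2(1) b t by (simp add: C_def powr_mult powr_powr)
      ultimately show ?thesis by (simp add: mult_ac)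
    qed
    finally show ?thesis using fin by blast
  qed
  show ?thesis by (rule that[OF C main])
qed

lemma weak_bound:
  assumes eq: "s' = q"
  obtains C where "C > 0"
    "\<And>h b c R l. Morrey_bounded q \<kappa> (b powr q) h \<Longrightarrow> 0 < b \<Longrightarrow> R > 0 \<Longrightarrow> l > 0 \<Longrightarrow>
      emeasure lborel {x \<in> ball c R. ennreal l < rough_potential \<Lambda> \<alpha> h x}
        \<le> ennreal ((C * b / l) powr t * measure lborel (ball c R) powr \<kappa>)"
proof -
  obtain C1 where C1: "C1 > 0"
    "\<And>h b x W. Morrey_bounded q \<kappa> (b powr q) h \<Longrightarrow> 0 < b \<Longrightarrow>
      0 < W \<Longrightarrow> maximal_function (\<lambda>y. h y powr s') x \<le> ennreal W \<Longrightarrow>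
      rough_potential \<Lambda> \<alpha> h x \<le> ennreal (C1 * W powr ((1 - \<alpha> / \<beta>) / s') * b powr (\<alpha> / \<beta>))"
    using pointwise_bound by blast
  define A :: real where "A = 15 ^ DIM('a) + 1"
  have A: "A > 0" by (simp add: A_def add_pos_pos)
  define C where "C = C1 * A powr (1 / t)"
  have C: "C > 0" using C1 A by (simp add: C_def)
  have main: "emeasure lborel {x \<in> ball c R. ennreal l < rough_potential \<Lambda> \<alpha> h x}
        \<le> ennreal ((C * b / l) powr t * measure lborel (ball c R) powr \<kappa>)"
    if bounded: "Morrey_bounded q \<kappa> (b powr q) h" and b: "0 < b" and R: "R > 0" and l: "l > 0"
    for h :: "'a \<Rightarrow> real" and b c R l
  proof -
    have h[measurable]: "h \<in> borel_measurable borel" and nn: "\<And>y. 0 \<le> h y"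
      and morrey: "\<And>c R. R > 0 \<Longrightarrow> (\<integral>\<^sup>+y\<in>ball c R. ennreal (h y powr q) \<partial>lborel)
        \<le> ennreal (b powr q * measure lborel (ball c R) powr \<kappa>)"
      using bounded by (auto simp: Morrey_bounded_def)
    \<comment> \<open>The level at which the pointwise bound equals \<open>l\<close>: for s' = q the
      exponent of \<open>W\<close> in that bound is 1/t. A potential above \<open>l\<close> thus
      forces the maximal function above \<open>W\<close>.\<close>
    define W where "W = (l / (C1 * b powr (\<alpha> / \<beta>))) powr t"
    have W: "W > 0" using l C1 b by (simp add: W_def)
    have one: "t * ((1 - \<alpha> / \<beta>) / s') = 1"
      using t(2) eq pos by (simp add: mult.commute)
    have "W powr ((1 - \<alpha> / \<beta>) / s') = l / (C1 * b powr (\<alpha> / \<beta>))"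
      unfolding W_def powr_powr one using l C1(1) b by simp
    then have "C1 * W powr ((1 - \<alpha> / \<beta>) / s') * b powr (\<alpha> / \<beta>) = l"
      using C1(1) b by simp
    then have bound: "rough_potential \<Lambda> \<alpha> h x \<le> ennreal l"
      if "maximal_function (\<lambda>y. h y powr s') x \<le> ennreal W" for x
      using C1(2)[OF bounded b W that] by simp
    have "{x \<in> ball c R. ennreal l < rough_potential \<Lambda> \<alpha> h x}
        \<subseteq> {x \<in> ball c R. ennreal W < maximal_function (\<lambda>y. h y powr s') x}"
      using bound by (auto simp: not_le[symmetric])
    moreover have "{x \<in> ball c R. ennreal W < maximal_function (\<lambda>y. h y powr s') x}
        = ball c R \<inter> {x. ennreal W < maximal_function (\<lambda>y. h y powr s') x}" by auto
    then have "{x \<in> ball c R. ennreal W < maximal_function (\<lambda>y. h y powr s') x} \<in> sets lborel"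
      by (simp add: open_maximal_function_superlevel)
    ultimately have "emeasure lborel {x \<in> ball c R. ennreal l < rough_potential \<Lambda> \<alpha> h x}
        \<le> emeasure lborel {x \<in> ball c R. ennreal W < maximal_function (\<lambda>y. h y powr s') x}"
      by (rule emeasure_mono)
    also have "\<dots> \<le> ennreal (A * b powr q * measure lborel (ball c R) powr \<kappa> / W)"
      unfolding A_def using morrey R W \<kappa> eq by (intro maximal_function_Morrey_weak_type) auto
    also have "A * b powr q * measure lborel (ball c R) powr \<kappa> / W
        = (C * b / l) powr t * measure lborel (ball c R) powr \<kappa>"
    proof -
      have "\<alpha> / \<beta> * t + q = t" unfolding t(2)[symmetric] by (simp add: left_diff_distrib)
      then have *: "b powr t = b powr (\<alpha> / \<beta> * t) * b powr q" by (simp flip: powr_add)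
      have "W = l powr t / (C1 powr t * b powr (\<alpha> / \<beta> * t))"
        using l C1(1) b by (simp add: W_def powr_divide powr_mult powr_powr)
      moreover have "(C * b / l) powr t = C1 powr t * A * b powr t / l powr t"
        using C1(1) A b t l by (simp add: C_def powr_divide powr_mult powr_powr)
      ultimately show ?thesis
        using l by (simp add: *)
    qed
    finally show ?thesis .
  qed
  show ?thesis by (rule that[OF C main])
qed

end

section \<open>The Bochner integral and its positive majorant\<close>

lemma rough_kernel_AE_eq:
  fixes \<Omega> \<Lambda> :: "'a::euclidean_space \<Rightarrow> complex"
  assumes \<Omega>: "AE z in lborel. \<Omega> z = \<Lambda> z" and g: "AE y in lborel. g y = g' y"
  shows "AE y in lborel. rough_kernel \<Omega> \<alpha> (x - y) * g y = rough_kernel \<Lambda> \<alpha> (x - y) * g' y"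
proof -
  have "AE y in lborel. \<Omega> (x - y) = \<Lambda> (x - y)"
    using AE_lborel_affine[OF _ \<Omega>, of "- 1" x] by simp
  then show ?thesis
    using g by eventually_elim (simp add: rough_kernel_def)
qed

lemma norm_rough_kernel:
  "norm (rough_kernel \<Lambda> \<alpha> z) = norm (\<Lambda> z) * norm z powr (\<alpha> - real DIM('a))"
  for z :: "'a::euclidean_space"
proof -
  \<comment> \<open>Also true at the origin, where both sides are 0 by the conventions for
    \<open>powr\<close> and division.\<close>
  have "norm z powr (\<alpha> - real DIM('a)) = 1 / norm z powr (real DIM('a) - \<alpha>)"
    using powr_minus_divide[of "norm z" "real DIM('a) - \<alpha>"] by simp
  then show ?thesis by (simp add: rough_kernel_def norm_divide)
qed

text \<open>For every fixed x, changing \<Omega> and g on null sets changes the integrand on a null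
  set of y, so the integral keeps its value at every x and is Borel in x. The norm bound too holds
  at every x: without integrability the left-hand side is 0.\<close>

lemma rough_integral_versions:
  fixes \<Omega> \<Lambda> g g' :: "'a::euclidean_space \<Rightarrow> complex"
  assumes \<Lambda>[measurable]: "\<Lambda> \<in> borel_measurable borel" and \<Omega>: "AE z in lborel. \<Omega> z = \<Lambda> z"
    and g'[measurable]: "g' \<in> borel_measurable borel" and g: "AE y in lborel. g y = g' y"
  shows "rough_integral \<Omega> \<alpha> g \<in> borel_measurable borel"
    and "ennreal (norm (rough_integral \<Omega> \<alpha> g x)) \<le> rough_potential \<Lambda> \<alpha> (\<lambda>y. norm (g' y)) x"
    and "rough_potential \<Lambda> \<alpha> (\<lambda>y. norm (g' y)) x < \<infinity> \<Longrightarrow>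
      integrable lebesgue (\<lambda>y. rough_kernel \<Omega> \<alpha> (x - y) * g y)"
proof -
  define K where "K x y = rough_kernel \<Lambda> \<alpha> (x - y) * g' y" for x y
  have K[measurable]: "case_prod K \<in> borel_measurable (borel \<Otimes>\<^sub>M borel)"
    unfolding K_def[abs_def] rough_kernel_def[abs_def] by measurable
  have Kx[measurable]: "K x \<in> borel_measurable borel" for x by measurable
  have ae: "AE y in lborel. rough_kernel \<Omega> \<alpha> (x - y) * g y = K x y" for x
    unfolding K_def by (rule rough_kernel_AE_eq[OF \<Omega> g])
  have meas: "(\<lambda>y. rough_kernel \<Omega> \<alpha> (x - y) * g y) \<in> borel_measurable lebesgue" for x
    by (rule borel_measurable_completion_AE[OF _ ae]) simp
  have measK: "K x \<in> borel_measurable lebesgue" for x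
    by (rule measurable_completion) simp
  have eq: "rough_integral \<Omega> \<alpha> g x = (\<integral>y. K x y \<partial>lborel)" for x
  proof -
    have "rough_integral \<Omega> \<alpha> g x = (\<integral>y. K x y \<partial>lebesgue)"
      unfolding rough_integral_def by (rule integral_cong_AE[OF meas measK AE_completion[OF ae]])
    also have "\<dots> = (\<integral>y. K x y \<partial>lborel)"
      by (rule integral_completion) simp
    finally show ?thesis .
  qed
  show "rough_integral \<Omega> \<alpha> g \<in> borel_measurable borel"
    unfolding eq[abs_def] by measurable
  have pot: "(\<integral>\<^sup>+y. ennreal (norm (K x y)) \<partial>lborel) = rough_potential \<Lambda> \<alpha> (\<lambda>y. norm (g' y)) x" for x
    unfolding rough_potential_def
    by (intro nn_integral_cong) (simp add: K_def norm_mult norm_rough_kernel mult_ac)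
  show "ennreal (norm (rough_integral \<Omega> \<alpha> g x)) \<le> rough_potential \<Lambda> \<alpha> (\<lambda>y. norm (g' y)) x"
  proof (cases "integrable lborel (K x)")
    case True
    then show ?thesis unfolding eq pot[symmetric] by (rule integral_norm_bound_ennreal)
  next
    case False
    then show ?thesis unfolding eq by (simp add: not_integrable_integral_eq)
  qed
  show "integrable lebesgue (\<lambda>y. rough_kernel \<Omega> \<alpha> (x - y) * g y)"
    if "rough_potential \<Lambda> \<alpha> (\<lambda>y. norm (g' y)) x < \<infinity>"
  proof -
    have "integrable lborel (K x)"
      using that by (intro integrableI_bounded) (auto simp: pot)
    then have "integrable lebesgue (K x)"
      by (subst integrable_completion) auto
    then show ?thesis
      by (subst integrable_cong_AE[OF meas measK AE_completion[OF ae]])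
  qed
qed

lemma AE_if_AE_balls:
  assumes "\<And>R. R > 0 \<Longrightarrow> AE x in M. x \<in> ball (0::'a::real_normed_vector) R \<longrightarrow> P x"
  shows "AE x in M. P x"
proof -
  have "AE x in M. \<forall>k. x \<in> ball 0 (real (Suc k)) \<longrightarrow> P x"
    unfolding AE_all_countable using assms by simp
  then show ?thesis
  proof eventually_elim
    case (elim x)
    obtain k where "norm x < real k" using reals_Archimedean2 by blast
    then have "x \<in> ball 0 (real (Suc k))" by simp
    then show ?case using elim by blast
  qed
qed

context Morrey_exponents
begin

text \<open>At the endpoint finiteness is read off the weak estimate: on each ball the infinite set
  lies in all superlevel sets, whose measures tend to 0 as the level grows.\<close>

lemma weak_bound_finite_AE:
  assumes eq: "s' = q" and bounded: "Morrey_bounded q \<kappa> (b powr q) h" and b: "0 < b"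
  shows "AE x in lborel. rough_potential \<Lambda> \<alpha> h x < \<infinity>"
proof (rule AE_if_AE_balls)
  fix R :: real assume R: "R > 0"
  have [measurable]: "h \<in> borel_measurable borel" using bounded by (simp add: Morrey_bounded_def)
  have [measurable]: "ball (0::'a) R \<in> sets borel" by simp
  obtain C where C: "C > 0"
    "\<And>h b c R l. Morrey_bounded q \<kappa> (b powr q) h \<Longrightarrow> 0 < b \<Longrightarrow> R > 0 \<Longrightarrow> l > 0 \<Longrightarrow>
      emeasure lborel {x \<in> ball c R. ennreal l < rough_potential \<Lambda> \<alpha> h x}
        \<le> ennreal ((C * b / l) powr t * measure lborel (ball c R) powr \<kappa>)"
    using weak_bound[OF eq] by blast
  let ?m = "measure lborel (ball (0::'a) R) powr \<kappa>"
  let ?N = "{x \<in> space lborel. x \<in> ball 0 R \<and> rough_potential \<Lambda> \<alpha> h x = \<infinity>}"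
  have N: "?N \<in> sets lborel" by measurable
  have "emeasure lborel ?N \<le> ennreal ((C * b / real (Suc k)) powr t * ?m)" for k
  proof -
    have "emeasure lborel ?N \<le> emeasure lborel {x \<in> space lborel. x \<in> ball 0 R \<and> ennreal (real (Suc k)) < rough_potential \<Lambda> \<alpha> h x}"
      by (intro emeasure_mono) (auto simp del: of_nat_Suc, measurable)
    also have "\<dots> \<le> ennreal ((C * b / real (Suc k)) powr t * ?m)"
      using C(2)[OF bounded b R, of "real (Suc k)" 0] by simp
    finally show ?thesis .
  qed
  moreover have "(\<lambda>k. ennreal ((C * b / real (Suc k)) powr t * ?m)) \<longlonglongrightarrow> ennreal 0"
  proof -
    have "(\<lambda>k. C * b / real (Suc k)) \<longlonglongrightarrow> 0"
      by (intro real_tendsto_divide_at_top[OF tendsto_const]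
        filterlim_compose[OF filterlim_real_sequentially filterlim_Suc])
    then have "(\<lambda>k. (C * b / real (Suc k)) powr t * ?m) \<longlonglongrightarrow> 0 powr t * ?m"
      using t(1) C(1) b by (intro tendsto_mult tendsto_const tendsto_powr') auto
    then have "(\<lambda>k. (C * b / real (Suc k)) powr t * ?m) \<longlonglongrightarrow> 0" by simp
    then show ?thesis by (rule tendsto_ennrealI)
  qed
  ultimately have "emeasure lborel ?N \<le> ennreal 0"
    by (intro LIMSEQ_le_const) auto
  then show "AE x in lborel. x \<in> ball 0 R \<longrightarrow> rough_potential \<Lambda> \<alpha> h x < \<infinity>"
    by (intro AE_I[OF _ _ N]) (auto simp: less_top[symmetric])
qed

end

lemma Morrey_bounded_borel_version:
  fixes g :: "'a::euclidean_space \<Rightarrow> complex"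
  assumes g: "g \<in> borel_measurable lebesgue" and le: "morrey_norm q \<kappa> g \<le> ennreal b" and "0 < q" "0 < b"
  obtains g' where "g' \<in> borel_measurable borel" "AE y in lborel. g y = g' y"
    "Morrey_bounded q \<kappa> (b powr q) (\<lambda>y. norm (g' y))"
proof -
  obtain g' where g': "g' \<in> borel_measurable lborel" "AE y in lborel. g y = g' y"
    using completion_ex_borel_measurable_complex[OF g] by blast
  have "(\<integral>\<^sup>+y\<in>ball c R. ennreal (norm (g' y) powr q) \<partial>lborel)
      \<le> ennreal (b powr q * measure lborel (ball c R) powr \<kappa>)" if "R > 0" for c R
  proof -
    have "(\<integral>\<^sup>+y\<in>ball c R. ennreal (norm (g' y) powr q) \<partial>lborel)
        = (\<integral>\<^sup>+y\<in>ball c R. ennreal (norm (g y) powr q) \<partial>lebesgue)"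
      unfolding nn_integral_completion
      using g'(2) by (intro nn_integral_cong_AE, elim eventually_mono) simp
    then show ?thesis
      using morrey_norm_leD[OF le assms(3) that] assms(4) by simp
  qed
  then have "Morrey_bounded q \<kappa> (b powr q) (\<lambda>y. norm (g' y))"
    using g'(1) assms by (auto simp: Morrey_bounded_def)
  then show ?thesis using that g' by simp
qed

text \<open>Adams' bound for the operator itself, in both ranges and with one constant, stated ball
  by ball and for every positive \<open>b\<close> above the norm so that it fits the product
  estimates.\<close>

lemma rough_integral_Morrey:
  fixes \<Omega> :: "'a::euclidean_space \<Rightarrow> complex"
  assumes s: "1 < s" "1 / s + 1 / ennreal s' = 1"
    and \<Omega>: "\<Omega> \<in> Lp_space sphere_measure s" "homogeneous_degree_zero \<Omega>"
    and \<alpha>: "0 < \<alpha>" "\<alpha> < real DIM('a)" and \<kappa>: "0 < \<kappa>" "\<kappa> < 1" and q: "s' \<le> q"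
    and t: "0 < t" "1 / t = 1 / q - \<alpha> / (real DIM('a) * (1 - \<kappa>))"
  obtains C where "C > 0"
    "\<And>g b. g \<in> borel_measurable lebesgue \<Longrightarrow> 0 < b \<Longrightarrow> morrey_norm q \<kappa> g \<le> ennreal b \<Longrightarrow>
      (AE x in lebesgue. integrable lebesgue (\<lambda>y. rough_kernel \<Omega> \<alpha> (x - y) * g y)) \<and>
      rough_integral \<Omega> \<alpha> g \<in> borel_measurable lebesgue \<and>
      (s' < q \<longrightarrow> (\<forall>c. \<forall>R>0. (\<integral>\<^sup>+x\<in>ball c R. ennreal (norm (rough_integral \<Omega> \<alpha> g x) powr t) \<partial>lebesgue)
        \<le> ennreal ((C * b) powr t * measure lborel (ball c R) powr \<kappa>))) \<and>
      (s' = q \<longrightarrow> (\<forall>c. \<forall>R>0. \<forall>l>0. emeasure lebesgue {x \<in> ball c R. l < norm (rough_integral \<Omega> \<alpha> g x)}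
        \<le> ennreal ((C * b / l) powr t * measure lborel (ball c R) powr \<kappa>)))"
proof -
  let ?d = "real DIM('a)"
  have s': "1 \<le> s'" using s by (cases rule: conjugate_exponent_cases) auto
  then have q0: "q > 0" using q by simp
  have d: "?d * (1 - \<kappa>) > 0" using \<kappa> by simp
  obtain \<Lambda> C0 where kernel: "local_Holder_kernel s' C0 \<Lambda>" and ae: "AE z in lborel. \<Omega> z = \<Lambda> z"
    using homogeneous_kernel_Holder[OF s \<Omega>] by blast
  define \<beta> where "\<beta> = ?d * (1 - \<kappa>) / q"
  \<comment> \<open>Positivity of 1/t is the condition \<alpha> < \<beta> in disguise.\<close>
  have "0 < 1 / q - \<alpha> / (?d * (1 - \<kappa>))"
    unfolding t(2)[symmetric] using t(1) by simp
  then have "\<alpha> / (?d * (1 - \<kappa>)) < 1 / q" by linarith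
  then have \<beta>: "\<alpha> < \<beta>" using d q0 unfolding \<beta>_def by (simp add: field_simps)
  have "1 - \<alpha> / \<beta> = q * (1 / q - \<alpha> / (?d * (1 - \<kappa>)))"
    using d q0 by (simp add: \<beta>_def right_diff_distrib)
  also have "\<dots> = q * (1 / t)" by (simp only: t(2))
  finally have \<theta>: "(1 - \<alpha> / \<beta>) * t = q" using t(1) by simp
  interpret Morrey_exponents \<Lambda> C0 s' q t \<alpha> \<beta> \<kappa>
    by (rule Morrey_exponents.intro[OF kernel s' q \<alpha> \<kappa> \<beta>_def \<beta> t(1) \<theta>])
  have "\<exists>C>0. \<forall>h b c R. Morrey_bounded q \<kappa> (b powr q) h \<longrightarrow> 0 < b \<longrightarrow> R > 0 \<longrightarrow>
      (AE x in lborel. rough_potential \<Lambda> \<alpha> h x < \<infinity>) \<and>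
      (s' < q \<longrightarrow> (\<integral>\<^sup>+x\<in>ball c R. ennreal (enn2real (rough_potential \<Lambda> \<alpha> h x) powr t) \<partial>lborel)
        \<le> ennreal ((C * b) powr t * measure lborel (ball c R) powr \<kappa>)) \<and>
      (s' = q \<longrightarrow> (\<forall>l>0. emeasure lborel {x \<in> ball c R. ennreal l < rough_potential \<Lambda> \<alpha> h x}
        \<le> ennreal ((C * b / l) powr t * measure lborel (ball c R) powr \<kappa>)))"
  proof (cases "s' < q")
    case True
    obtain C where C: "C > 0" "\<And>h b c R. Morrey_bounded q \<kappa> (b powr q) h \<Longrightarrow> 0 < b \<Longrightarrow> R > 0 \<Longrightarrow>
      (AE x in lborel. x \<in> ball c R \<longrightarrow> rough_potential \<Lambda> \<alpha> h x < \<infinity>) \<and>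
      (\<integral>\<^sup>+x\<in>ball c R. ennreal (enn2real (rough_potential \<Lambda> \<alpha> h x) powr t) \<partial>lborel)
        \<le> ennreal ((C * b) powr t * measure lborel (ball c R) powr \<kappa>)"
      using strong_bound[OF True] by blast
    moreover have "AE x in lborel. rough_potential \<Lambda> \<alpha> h x < \<infinity>"
      if "Morrey_bounded q \<kappa> (b powr q) h" "0 < b" for h b
      by (rule AE_if_AE_balls) (rule conjunct1[OF C(2)[OF that]])
    ultimately show ?thesis using True by (intro exI[of _ C]) auto
  next
    case False
    then have eq: "s' = q" using q by simp
    obtain C where C: "C > 0" "\<And>h b c R l. Morrey_bounded q \<kappa> (b powr q) h \<Longrightarrow> 0 < b \<Longrightarrow> R > 0 \<Longrightarrow> l > 0 \<Longrightarrow>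
      emeasure lborel {x \<in> ball c R. ennreal l < rough_potential \<Lambda> \<alpha> h x}
        \<le> ennreal ((C * b / l) powr t * measure lborel (ball c R) powr \<kappa>)"
      using weak_bound[OF eq] by blast
    then show ?thesis
      using False weak_bound_finite_AE[OF eq] by (intro exI[of _ C]) auto
  qed
  then obtain C where C: "C > 0" and C2: "\<And>h b c R. Morrey_bounded q \<kappa> (b powr q) h \<Longrightarrow> 0 < b \<Longrightarrow> R > 0 \<Longrightarrow>
      (AE x in lborel. rough_potential \<Lambda> \<alpha> h x < \<infinity>) \<and>
      (s' < q \<longrightarrow> (\<integral>\<^sup>+x\<in>ball c R. ennreal (enn2real (rough_potential \<Lambda> \<alpha> h x) powr t) \<partial>lborel)
        \<le> ennreal ((C * b) powr t * measure lborel (ball c R) powr \<kappa>)) \<and>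
      (s' = q \<longrightarrow> (\<forall>l>0. emeasure lborel {x \<in> ball c R. ennreal l < rough_potential \<Lambda> \<alpha> h x}
        \<le> ennreal ((C * b / l) powr t * measure lborel (ball c R) powr \<kappa>)))"
    by blast
  have main: "(AE x in lebesgue. integrable lebesgue (\<lambda>y. rough_kernel \<Omega> \<alpha> (x - y) * g y)) \<and>
      rough_integral \<Omega> \<alpha> g \<in> borel_measurable lebesgue \<and>
      (s' < q \<longrightarrow> (\<forall>c. \<forall>R>0. (\<integral>\<^sup>+x\<in>ball c R. ennreal (norm (rough_integral \<Omega> \<alpha> g x) powr t) \<partial>lebesgue)
        \<le> ennreal ((C * b) powr t * measure lborel (ball c R) powr \<kappa>))) \<and>
      (s' = q \<longrightarrow> (\<forall>c. \<forall>R>0. \<forall>l>0. emeasure lebesgue {x \<in> ball c R. l < norm (rough_integral \<Omega> \<alpha> g x)}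
        \<le> ennreal ((C * b / l) powr t * measure lborel (ball c R) powr \<kappa>)))"
    if g: "g \<in> borel_measurable lebesgue" and b: "0 < b" and le: "morrey_norm q \<kappa> g \<le> ennreal b" for g b
  proof -
    obtain g' where g': "g' \<in> borel_measurable borel" "AE y in lborel. g y = g' y"
      and bounded: "Morrey_bounded q \<kappa> (b powr q) (\<lambda>y. norm (g' y))"
      using Morrey_bounded_borel_version[OF g le q0 b] by blast
    let ?I = "rough_potential \<Lambda> \<alpha> (\<lambda>y. norm (g' y))"
    note versions = rough_integral_versions[OF \<Lambda>_borel ae g'(1) g'(2), of \<alpha>]
    have T[measurable]: "rough_integral \<Omega> \<alpha> g \<in> borel_measurable borel" by (rule versions(1))
    have I[measurable]: "?I \<in> borel_measurable borel" using g'(1) by measurable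
    have fin: "AE x in lborel. ?I x < \<infinity>" using C2[OF bounded b, of 1] by simp
    have 1: "AE x in lebesgue. integrable lebesgue (\<lambda>y. rough_kernel \<Omega> \<alpha> (x - y) * g y)"
      using AE_completion[OF fin] by eventually_elim (rule versions(3))
    have 2: "rough_integral \<Omega> \<alpha> g \<in> borel_measurable lebesgue"
      by (rule measurable_completion) simp
    have 3: "(\<integral>\<^sup>+x\<in>ball c R. ennreal (norm (rough_integral \<Omega> \<alpha> g x) powr t) \<partial>lebesgue)
        \<le> ennreal ((C * b) powr t * measure lborel (ball c R) powr \<kappa>)" if "s' < q" "R > 0" for c R
    proof -
      have "(\<integral>\<^sup>+x\<in>ball c R. ennreal (norm (rough_integral \<Omega> \<alpha> g x) powr t) \<partial>lebesgue)
        \<le> (\<integral>\<^sup>+x\<in>ball c R. ennreal (enn2real (?I x) powr t) \<partial>lborel)"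
        unfolding nn_integral_completion using fin
      proof (intro nn_integral_mono_AE, eventually_elim)
        case (elim x)
        then have "norm (rough_integral \<Omega> \<alpha> g x) \<le> enn2real (?I x)"
          using versions(2)[of x] by (cases "?I x") auto
        then have "norm (rough_integral \<Omega> \<alpha> g x) powr t \<le> enn2real (?I x) powr t"
          using t by (intro powr_mono2) auto
        then show ?case by (intro mult_right_mono ennreal_leI) auto
      qed
      also have "\<dots> \<le> ennreal ((C * b) powr t * measure lborel (ball c R) powr \<kappa>)"
        using C2[OF bounded b that(2)] that(1) by blast
      finally show ?thesis .
    qed
    have 4: "emeasure lebesgue {x \<in> ball c R. l < norm (rough_integral \<Omega> \<alpha> g x)}
        \<le> ennreal ((C * b / l) powr t * measure lborel (ball c R) powr \<kappa>)"
      if "s' = q" "R > 0" "l > 0" for c R l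
    proof -
      have [measurable]: "ball c R \<in> sets borel" by simp
      have "{x \<in> space lborel. x \<in> ball c R \<and> ennreal l < ?I x} \<in> sets lborel" by measurable
      then have meas: "{x \<in> ball c R. ennreal l < ?I x} \<in> sets lborel" by simp
      have meas': "{x \<in> ball c R. l < norm (rough_integral \<Omega> \<alpha> g x)} \<in> sets lborel"
        by (rule sets_norm_superlevel) (use T in simp_all)
      have "emeasure lebesgue {x \<in> ball c R. l < norm (rough_integral \<Omega> \<alpha> g x)}
          = emeasure lborel {x \<in> ball c R. l < norm (rough_integral \<Omega> \<alpha> g x)}"
        using meas' by simp
      also have "\<dots> \<le> emeasure lborel {x \<in> ball c R. ennreal l < ?I x}"
      proof (rule emeasure_mono[OF _ meas], safe)
        fix x assume "l < norm (rough_integral \<Omega> \<alpha> g x)"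
        then have "ennreal l < ennreal (norm (rough_integral \<Omega> \<alpha> g x))"
          using that by (simp add: ennreal_less_iff)
        then show "ennreal l < ?I x" using versions(2)[of x] by (rule order.strict_trans2)
      qed
      also have "\<dots> \<le> ennreal ((C * b / l) powr t * measure lborel (ball c R) powr \<kappa>)"
        using C2[OF bounded b that(2)] that(1,3) by blast
      finally show ?thesis .
    qed
    show ?thesis using 1 2 3 4 by blast
  qed
  show ?thesis by (rule that[OF C main])
qed

text \<open>The estimates need strictly positive bounds, whereas a norm may be 0. They are applied
  to norm + 1/(k+1), and k tends to infinity.\<close>

lemma le_mult_of_le_upper_bounds:
  fixes X A B :: ennreal
  assumes C: "0 \<le> C" and AB: "A < \<infinity>" "B < \<infinity>"
    and le: "\<And>a b. 0 < a \<Longrightarrow> 0 < b \<Longrightarrow> A \<le> ennreal a \<Longrightarrow> B \<le> ennreal b \<Longrightarrow> X \<le> ennreal (C * a * b)"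
  shows "X \<le> ennreal C * A * B"
proof -
  obtain A' where A': "A = ennreal A'" "A' \<ge> 0" using AB(1) by (cases A) auto
  obtain B' where B': "B = ennreal B'" "B' \<ge> 0" using AB(2) by (cases B) auto
  have "(\<lambda>k. ennreal (C * (A' + inverse (real (Suc k))) * (B' + inverse (real (Suc k)))))
      \<longlonglongrightarrow> ennreal (C * (A' + 0) * (B' + 0))"
    by (intro tendsto_ennrealI tendsto_intros LIMSEQ_inverse_real_of_nat)
  moreover have "X \<le> ennreal (C * (A' + inverse (real (Suc k))) * (B' + inverse (real (Suc k))))" for k
    using A' B' by (intro le) (auto intro!: ennreal_leI add_nonneg_pos simp del: of_nat_Suc)
  ultimately have "X \<le> ennreal (C * (A' + 0) * (B' + 0))"
    by (intro LIMSEQ_le_const) auto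
  also have "\<dots> = ennreal C * A * B"
    using A' B' C by (simp add: ennreal_mult)
  finally show ?thesis .
qed

text \<open>Absolute convergence for almost every x is part of both conclusions: otherwise the value
  0 of a divergent Bochner integral could satisfy the bounds without meaning. Membership in the
  spaces adds measurability and finiteness.\<close>

theorem theorem3p6:
  fixes \<Omega> :: "real ^ 'n \<Rightarrow> complex"
    and s :: ennreal
    and s' p q r \<alpha> \<kappa> :: real
  assumes "CARD('n) \<ge> 2"
    and "1 < s"
    and "1 / s + 1 / ennreal s' = 1"
    and "\<Omega> \<in> Lp_space sphere_measure s"
    and "homogeneous_degree_zero \<Omega>"
    and "0 < \<alpha>" and "\<alpha> < real CARD('n)"
    and "s' \<le> p" and "s' \<le> q"
    and "1 / p + 1 / q = 1 / r + \<alpha> / (real CARD('n) * (1 - \<kappa>))"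
    and "0 < r" and "r < min p q"
    and "0 < \<kappa>" and "\<kappa> < 1"
  shows "(s' < p \<and> s' < q \<longrightarrow>
            (\<exists>C::real. C > 0 \<and>
              (\<forall>f \<in> morrey_space p \<kappa>. \<forall>g \<in> morrey_space q \<kappa>.
                 (AE x in lebesgue. integrable lebesgue (\<lambda>y. rough_kernel \<Omega> \<alpha> (x - y) * g y)) \<and>
                 (\<lambda>x. f x * rough_integral \<Omega> \<alpha> g x) \<in> morrey_space r \<kappa> \<and>
                 morrey_norm r \<kappa> (\<lambda>x. f x * rough_integral \<Omega> \<alpha> g x)
                   \<le> ennreal C * morrey_norm p \<kappa> f * morrey_norm q \<kappa> g)))
       \<and> ((s' = p \<and> s' < q) \<or> (s' = q \<and> s' < p) \<longrightarrow>
            (\<exists>C::real. C > 0 \<and>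
              (\<forall>f \<in> morrey_space p \<kappa>. \<forall>g \<in> morrey_space q \<kappa>.
                 (AE x in lebesgue. integrable lebesgue (\<lambda>y. rough_kernel \<Omega> \<alpha> (x - y) * g y)) \<and>
                 (\<lambda>x. f x * rough_integral \<Omega> \<alpha> g x) \<in> weak_morrey_space r \<kappa> \<and>
                 weak_morrey_norm r \<kappa> (\<lambda>x. f x * rough_integral \<Omega> \<alpha> g x)
                   \<le> ennreal C * morrey_norm p \<kappa> f * morrey_norm q \<kappa> g)))"
proof -
  have r: "0 < r" "r < p" "r < q" using assms by auto
  define t where "t = 1 / (1 / r - 1 / p)"
  have "1 / p < 1 / r" using r by (simp add: frac_less2)
  then have t: "0 < t" and pt: "1 / p + 1 / t = 1 / r" by (simp_all add: t_def)
  have qt: "1 / t = 1 / q - \<alpha> / (real DIM(real ^ 'n) * (1 - \<kappa>))"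
    using assms(10) pt by simp
  have \<alpha>: "\<alpha> < real DIM(real ^ 'n)" using assms by simp
  obtain C where C: "C > 0" and T: "\<And>g b. g \<in> borel_measurable lebesgue \<Longrightarrow> 0 < b \<Longrightarrow> morrey_norm q \<kappa> g \<le> ennreal b \<Longrightarrow>
      (AE x in lebesgue. integrable lebesgue (\<lambda>y. rough_kernel \<Omega> \<alpha> (x - y) * g y)) \<and>
      rough_integral \<Omega> \<alpha> g \<in> borel_measurable lebesgue \<and>
      (s' < q \<longrightarrow> (\<forall>c. \<forall>R>0. (\<integral>\<^sup>+x\<in>ball c R. ennreal (norm (rough_integral \<Omega> \<alpha> g x) powr t) \<partial>lebesgue)
        \<le> ennreal ((C * b) powr t * measure lborel (ball c R) powr \<kappa>))) \<and>
      (s' = q \<longrightarrow> (\<forall>c. \<forall>R>0. \<forall>l>0. emeasure lebesgue {x \<in> ball c R. l < norm (rough_integral \<Omega> \<alpha> g x)}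
        \<le> ennreal ((C * b / l) powr t * measure lborel (ball c R) powr \<kappa>)))"
    using rough_integral_Morrey[OF assms(2-6) \<alpha> assms(13,14,9) t qt] by blast
  \<comment> \<open>The factor \<open>2 powr (1 / r)\<close> is the cost of the weak product
    estimate.\<close>
  define D where "D = 2 powr (1 / r) * C"
  have D: "D > 0" using C by (simp add: D_def)
  have basic: "(AE x in lebesgue. integrable lebesgue (\<lambda>y. rough_kernel \<Omega> \<alpha> (x - y) * g y)) \<and>
      rough_integral \<Omega> \<alpha> g \<in> borel_measurable lebesgue"
    if g: "g \<in> morrey_space q \<kappa>" for g
  proof -
    obtain b where "morrey_norm q \<kappa> g = ennreal b" "b \<ge> 0"
      using g by (cases "morrey_norm q \<kappa> g") (auto simp: morrey_space_def)
    \<comment> \<open>Adding 1 supplies a strictly positive bound, even for a g of norm 0.\<close>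
    then show ?thesis
      using T[of g "b + 1"] g by (auto simp: morrey_space_def ennreal_leI)
  qed
  have product_measurable: "(\<lambda>x. f x * rough_integral \<Omega> \<alpha> g x) \<in> borel_measurable lebesgue"
    if "f \<in> morrey_space p \<kappa>" "g \<in> morrey_space q \<kappa>" for f g
    using basic[OF that(2)] that(1) by (intro borel_measurable_times) (auto simp: morrey_space_def)
  have product: "(\<integral>\<^sup>+x\<in>ball c R. ennreal (norm (f x * rough_integral \<Omega> \<alpha> g x) powr r) \<partial>lebesgue)
      \<le> ennreal ((C * a * b) powr r * measure lborel (ball c R) powr \<kappa>)"
    if "s' < q" and f: "f \<in> borel_measurable lebesgue" and g: "g \<in> borel_measurable lebesgue"
      and ab: "0 < a" "0 < b" and le: "morrey_norm p \<kappa> f \<le> ennreal a" "morrey_norm q \<kappa> g \<le> ennreal b"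
      and R: "R > 0"
    for f g a b c R
  proof -
    have "(\<integral>\<^sup>+x\<in>ball c R. ennreal (norm (f x * rough_integral \<Omega> \<alpha> g x) powr r) \<partial>lebesgue)
      \<le> ennreal ((a * (C * b)) powr r * measure lborel (ball c R) powr \<kappa>)"
      using f T[OF g ab(2) le(2)] \<open>s' < q\<close> R r t pt ab C morrey_norm_leD[OF le(1)]
      by (intro nn_integral_powr_product_le[where p = p and t = t]) auto
    then show ?thesis by (simp add: mult_ac)
  qed
  have strong: "morrey_norm r \<kappa> (\<lambda>x. f x * rough_integral \<Omega> \<alpha> g x)
      \<le> ennreal C * morrey_norm p \<kappa> f * morrey_norm q \<kappa> g"
    if "s' < q" and f: "f \<in> morrey_space p \<kappa>" and g: "g \<in> morrey_space q \<kappa>" for f g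
  proof (rule le_mult_of_le_upper_bounds)
    fix a b :: real
    assume ab: "0 < a" "0 < b" and le: "morrey_norm p \<kappa> f \<le> ennreal a" "morrey_norm q \<kappa> g \<le> ennreal b"
    have "f \<in> borel_measurable lebesgue" "g \<in> borel_measurable lebesgue"
      using f g by (auto simp: morrey_space_def)
    from product[OF \<open>s' < q\<close> this ab le]
    show "morrey_norm r \<kappa> (\<lambda>x. f x * rough_integral \<Omega> \<alpha> g x) \<le> ennreal (C * a * b)"
      using r C ab by (intro morrey_norm_leI) auto
  qed (use f g C in \<open>auto simp: morrey_space_def\<close>)
  have weak: "weak_morrey_norm r \<kappa> (\<lambda>x. f x * rough_integral \<Omega> \<alpha> g x)
      \<le> ennreal D * morrey_norm p \<kappa> f * morrey_norm q \<kappa> g"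
    if f: "f \<in> morrey_space p \<kappa>" and g: "g \<in> morrey_space q \<kappa>" for f g
  proof (rule le_mult_of_le_upper_bounds)
    fix a b :: real
    assume ab: "0 < a" "0 < b" and le: "morrey_norm p \<kappa> f \<le> ennreal a" "morrey_norm q \<kappa> g \<le> ennreal b"
    have f': "f \<in> borel_measurable lebesgue" and g': "g \<in> borel_measurable lebesgue"
      using f g by (auto simp: morrey_space_def)
    note T' = T[OF g' ab(2) le(2)]
    show "weak_morrey_norm r \<kappa> (\<lambda>x. f x * rough_integral \<Omega> \<alpha> g x) \<le> ennreal (D * a * b)"
    proof (rule weak_morrey_norm_leI)
      fix c :: "real ^ 'n" and R l :: real assume R: "R > 0" and l: "l > 0"
      define m where "m = measure lborel (ball c R) powr \<kappa>"
      have m: "m \<ge> 0" by (simp add: m_def)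
      have ball: "ball c R \<in> sets lebesgue" by simp
      \<comment> \<open>For s' < q the strong bound is weakened by Chebyshev's inequality, for s' =
        q the weak bound applies directly; so one argument serves both alternatives of the second
        claim.\<close>
      have Tl: "emeasure lebesgue {x \<in> ball c R. l < norm (rough_integral \<Omega> \<alpha> g x)}
          \<le> ennreal ((C * b / l) powr t * m)" if l: "l > 0" for l
      proof (cases "s' < q")
        case True
        then show ?thesis
          using T' R l C ab t m by (intro emeasure_superlevel_le) (auto simp: m_def)
      next
        case False
        then show ?thesis using T' R l assms(9) by (auto simp: m_def)
      qed
      have fl: "emeasure lebesgue {x \<in> ball c R. l < norm (f x)} \<le> ennreal ((a / l) powr p * m)" if l: "l > 0" for l
        using morrey_norm_leD[OF le(1) _ R, of c] r l ab m f'
        by (intro emeasure_superlevel_le) (auto simp: m_def)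
      have "emeasure lebesgue {x \<in> ball c R. l < norm (f x * rough_integral \<Omega> \<alpha> g x)}
          \<le> ennreal ((2 powr (1 / r) * a * (C * b) / l) powr r * m)"
        using r t pt ab C m l f' T' ball
        by (intro emeasure_superlevel_product_le[where p = p and t = t] fl Tl) auto
      then show "emeasure lebesgue {x \<in> ball c R. l < norm (f x * rough_integral \<Omega> \<alpha> g x)}
          \<le> ennreal ((D * a * b / l) powr r * measure lborel (ball c R) powr \<kappa>)"
        by (simp add: D_def m_def mult_ac)
    qed (use r D ab in auto)
  qed (use f g D in \<open>auto simp: morrey_space_def\<close>)
  have finite: "ennreal E * morrey_norm p \<kappa> f * morrey_norm q \<kappa> g < \<infinity>"
    if "f \<in> morrey_space p \<kappa>" "g \<in> morrey_space q \<kappa>" for f g E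
    using that by (auto simp: morrey_space_def ennreal_mult_less_top)
  show ?thesis
  proof (intro conjI impI)
    assume "s' < p \<and> s' < q"
    then show "\<exists>C::real. C > 0 \<and>
              (\<forall>f \<in> morrey_space p \<kappa>. \<forall>g \<in> morrey_space q \<kappa>.
                 (AE x in lebesgue. integrable lebesgue (\<lambda>y. rough_kernel \<Omega> \<alpha> (x - y) * g y)) \<and>
                 (\<lambda>x. f x * rough_integral \<Omega> \<alpha> g x) \<in> morrey_space r \<kappa> \<and>
                 morrey_norm r \<kappa> (\<lambda>x. f x * rough_integral \<Omega> \<alpha> g x)
                   \<le> ennreal C * morrey_norm p \<kappa> f * morrey_norm q \<kappa> g)"
      using C basic product_measurable strong order.strict_trans1[OF strong finite]
      unfolding morrey_space_def[of r] by (intro exI[of _ C]) blast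
  next
    show "\<exists>C::real. C > 0 \<and>
              (\<forall>f \<in> morrey_space p \<kappa>. \<forall>g \<in> morrey_space q \<kappa>.
                 (AE x in lebesgue. integrable lebesgue (\<lambda>y. rough_kernel \<Omega> \<alpha> (x - y) * g y)) \<and>
                 (\<lambda>x. f x * rough_integral \<Omega> \<alpha> g x) \<in> weak_morrey_space r \<kappa> \<and>
                 weak_morrey_norm r \<kappa> (\<lambda>x. f x * rough_integral \<Omega> \<alpha> g x)
                   \<le> ennreal C * morrey_norm p \<kappa> f * morrey_norm q \<kappa> g)"
      using D basic product_measurable weak order.strict_trans1[OF weak finite]
      unfolding weak_morrey_space_def by (intro exI[of _ D]) blast
  qed
qed

end
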